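(* Let $X$ and $M$ be real Banach spaces, let $\mathcal{U}\subset X$ and $\mathcal{O}\subset M$ be open subsets, let $J:\mathcal{U}\times\mathcal{O}\to\mathbb{R}$ be a real valued functional, and fix $\mu_0\in\mathcal{O}$. Assume: 1. $J(\cdot,\mu)\in C^2(\mathcal{U})$ for every $\mu\in\mathcal{O}$, and $\partial_XJ\in C^0(\mathcal{U}\times\mathcal{O},X')$; 2. $u_0\in\mathcal{U}$ satisfies $\partial_XJ(u_0,\mu_0)=0$; 3. $\partial_X^2J$ is continuous at $(w,\mu)=(u_0,\mu_0)$; 4. there exists $\alpha>0$ such that $\partial_X^2J(u_0,\mu_0)[w,w]\ge\alpha\|w\|_X^2$ for all $w\in X$. Assume additionally that $J\in C^k(\mathcal{U}\times\mathcal{O})$ for some integer $k\ge1$. Then there exist a convex open neighborhood $\mathcal{U}_0\times\mathcal{O}_0\subset\mathcal{U}\times\mathcal{O}$ of $(u_0,\mu_0)$ and a map $u\in C^0(\mathcal{O}_0,\mathcal{U}_0)$ such that, for every $\mu\in\mathcal{O}_0$, the conditions (a) $w\in\mathcal{U}_0$ is a local minimizer of $J(\cdot,\mu)$; (b) $w\in\mathcal{U}_0$ satisfies $\partial_XJ(w,\mu)=0$; (c) $w=u(\mu)$ are equivalent, $u(\mu)$ is a global minimizer of $J(\cdot,\mu)$ on $\mathcal{U}_0$, and the function $J_*(\mu):=J(u(\mu),\mu)$ $(\mu\in\mathcal{O}_0)$ satisfies $J_*\in C^k(\mathcal{O}_0)$ and $$J_*'(\mu)=\partial_MJ(u(\m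u),\mu)\qquad(\mu\in\mathcal{O}_0).$$
   Context: $X'$ is the dual space of $X$. $\partial_X$ and $\partial_M$ denote the partial Fréchet derivatives of $J(w,\mu)$ with respect to $w\in X$ and $\mu\in M$; $\partial_X^2J$ is the second partial Fréchet derivative, regarded as a bounded bilinear form on $X$; $J_*'$ is the Fréchet derivative of $J_*$. $C^k$ means $k$ times continuously Fréchet differentiable. For a real valued functional $J$ on a metric space $S$, $u_0\in S$ is a global minimizer of $J$ in $S$ if $J(u_0)\le J(u)$ for all $u\in S$; it is a local minimizer if there is an open set $G\subset S$ containing $u_0$ such that $u_0$ is a global minimizer of $J$ in $G$. *)

theory Defs
  imports "HOL-Analysis.Analysis"
begin

text \<open>
  The \<open>i\<close>-th derivative at a point is a bounded \<open>i\<close>-linear map. Since the iterated type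
  \<open>'a \<Rightarrow>\<^sub>L \<dots> \<Rightarrow>\<^sub>L 'a \<Rightarrow>\<^sub>L 'b\<close> would depend on \<open>i\<close>, such a map is represented as a function on lists,
  of which only the values on lists of length \<open>i\<close> matter.
\<close>

definition bounded_multilinear ::
  "nat \<Rightarrow> ('a::real_normed_vector list \<Rightarrow> 'b::real_normed_vector) \<Rightarrow> bool" where
  "bounded_multilinear n T \<longleftrightarrow>
     (\<forall>vs i. length vs = n \<and> i < n \<longrightarrow> linear (\<lambda>v. T (vs[i := v]))) \<and>
     (\<exists>K. \<forall>vs. length vs = n \<longrightarrow> norm (T vs) \<le> K * (\<Prod>v\<leftarrow>vs. norm v))"

text \<open>The multilinear analogue of \<^const>\<open>onorm\<close>; meaningful for bounded \<open>n\<close>-linear maps only.\<close>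

definition multi_onorm ::
  "nat \<Rightarrow> ('a::real_normed_vector list \<Rightarrow> 'b::real_normed_vector) \<Rightarrow> real" where
  "multi_onorm n T = (SUP vs\<in>{vs. length vs = n}. norm (T vs) / (\<Prod>v\<leftarrow>vs. norm v))"

text \<open>
  \<open>Ck_on k f S\<close>: \<open>f\<close> is \<open>k\<close> times continuously Frechet differentiable on the open set \<open>S\<close>.
  Here \<open>D i x\<close> is the \<open>i\<close>-th derivative of \<open>f\<close> at \<open>x\<close>, the most recent direction of
  differentiation coming first in the list: the third conjunct says that
  \<open>h \<mapsto> D (Suc i) x (h # _)\<close> is the Frechet derivative at \<open>x\<close> of \<open>D i\<close>, as a map
  from \<open>S\<close> into the normed space of bounded \<open>i\<close>-linear maps. The last conjunct is the continuity
  of \<open>D k\<close> into the bounded \<open>k\<close>-linear maps.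
\<close>

definition Ck_on ::
  "nat \<Rightarrow> ('a::real_normed_vector \<Rightarrow> 'b::real_normed_vector) \<Rightarrow> 'a set \<Rightarrow> bool" where
  "Ck_on k f S \<longleftrightarrow> (\<exists>D :: nat \<Rightarrow> 'a \<Rightarrow> 'a list \<Rightarrow> 'b.
     (\<forall>x\<in>S. D 0 x [] = f x) \<and>
     (\<forall>i\<le>k. \<forall>x\<in>S. bounded_multilinear i (D i x)) \<and>
     (\<forall>i<k. \<forall>x\<in>S.
        ((\<lambda>y. multi_onorm i (\<lambda>vs. D i y vs - D i x vs - D (Suc i) x ((y - x) # vs)) / norm (y - x))
          \<longlongrightarrow> 0) (at x within S)) \<and>
     (\<forall>x\<in>S. ((\<lambda>y. multi_onorm k (\<lambda>vs. D k y vs - D k x vs)) \<longlongrightarrow> 0) (at x within S)))"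

text \<open>The Frechet derivative as an element of the space of bounded linear maps with its operator
  norm; unspecified where \<open>f\<close> is not differentiable.\<close>

definition fderiv ::
  "('a::real_normed_vector \<Rightarrow> 'b::real_normed_vector) \<Rightarrow> 'a \<Rightarrow> 'a \<Rightarrow>\<^sub>L 'b" where
  "fderiv f x = Blinfun (frechet_derivative f (at x))"

definition partial_X ::
  "('x::real_normed_vector \<times> 'm::real_normed_vector \<Rightarrow> real) \<Rightarrow> 'x \<times> 'm \<Rightarrow> 'x \<Rightarrow>\<^sub>L real" where
  "partial_X J = (\<lambda>(w, \<mu>). fderiv (\<lambda>w'. J (w', \<mu>)) w)"

definition partial_M ::
  "('x::real_normed_vector \<times> 'm::real_normed_vector \<Rightarrow> real) \<Rightarrow> 'x \<times> 'm \<Rightarrow> 'm \<Rightarrow>\<^sub>L real" where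
  "partial_M J = (\<lambda>(w, \<mu>). fderiv (\<lambda>\<mu>'. J (w, \<mu>')) \<mu>)"

text \<open>The space of bounded bilinear forms on \<open>'x\<close> is identified (isometrically) with
  \<open>'x \<Rightarrow>\<^sub>L 'x \<Rightarrow>\<^sub>L real\<close>.\<close>

definition partial_XX ::
  "('x::real_normed_vector \<times> 'm::real_normed_vector \<Rightarrow> real) \<Rightarrow> 'x \<times> 'm \<Rightarrow> 'x \<Rightarrow>\<^sub>L 'x \<Rightarrow>\<^sub>L real" where
  "partial_XX J = (\<lambda>(w, \<mu>). fderiv (\<lambda>w'. partial_X J (w', \<mu>)) w)"

definition global_minimizer :: "('a \<Rightarrow> real) \<Rightarrow> 'a set \<Rightarrow> 'a \<Rightarrow> bool" where
  "global_minimizer f S u \<longleftrightarrow> u \<in> S \<and> (\<forall>v\<in>S. f u \<le> f v)"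

definition local_minimizer :: "('a::topological_space \<Rightarrow> real) \<Rightarrow> 'a set \<Rightarrow> 'a \<Rightarrow> bool" where
  "local_minimizer f S u \<longleftrightarrow>
     (\<exists>G. openin (top_of_set S) G \<and> u \<in> G \<and> global_minimizer f G u)"

lemma prod_list_norm_nonneg: "0 \<le> (\<Prod>v\<leftarrow>vs. norm v)" for vs :: "'a::real_normed_vector list"
  by (induction vs) auto

lemma bm_linear: "bounded_multilinear n T \<Longrightarrow> length vs = n \<Longrightarrow> i < n \<Longrightarrow> linear (\<lambda>v. T (vs[i := v]))"
  unfolding bounded_multilinear_def by blast

lemma bm_bound:
  assumes "bounded_multilinear n T"
  obtains K where "K \<ge> 0" "\<And>vs. length vs = n \<Longrightarrow> norm (T vs) \<le> K * (\<Prod>v\<leftarrow>vs. norm v)"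
proof -
  from assms obtain K where K: "\<And>vs. length vs = n \<Longrightarrow> norm (T vs) \<le> K * (\<Prod>v\<leftarrow>vs. norm v)"
    unfolding bounded_multilinear_def by blast
  have "norm (T vs) \<le> max K 0 * (\<Prod>v\<leftarrow>vs. norm v)" if "length vs = n" for vs
    using K[OF that] mult_right_mono[OF max.cobounded1[of K 0] prod_list_norm_nonneg[of vs]] by linarith
  then show ?thesis using that[of "max K 0"] by auto
qed

lemma multi_onorm_le:
  fixes T :: "'a::real_normed_vector list \<Rightarrow> 'b::real_normed_vector"
  assumes "K \<ge> 0" "\<And>vs. length vs = n \<Longrightarrow> norm (T vs) \<le> K * (\<Prod>v\<leftarrow>vs. norm v)"
  shows "multi_onorm n T \<le> K"
  unfolding multi_onorm_def
proof (rule cSUP_least)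
  show "{vs::'a list. length vs = n} \<noteq> {}" using Ex_list_of_length by blast
next
  fix vs :: "'a list" assume "vs \<in> {vs. length vs = n}"
  then show "norm (T vs) / (\<Prod>v\<leftarrow>vs. norm v) \<le> K"
    using assms(2)[of vs] assms(1) prod_list_norm_nonneg[of vs]
    by (cases "(\<Prod>v\<leftarrow>vs. norm v) = 0") (auto simp: divide_le_eq)
qed

lemma multi_onorm_bound:
  assumes "bounded_multilinear n T" "length vs = n"
  shows "norm (T vs) \<le> multi_onorm n T * (\<Prod>v\<leftarrow>vs. norm v)"
proof -
  from assms(1) obtain K where K: "K \<ge> 0" "\<And>vs. length vs = n \<Longrightarrow> norm (T vs) \<le> K * (\<Prod>v\<leftarrow>vs. norm v)"
    by (rule bm_bound) blast
  have "bdd_above ((\<lambda>vs. norm (T vs) / (\<Prod>v\<leftarrow>vs. norm v)) ` {vs. length vs = n})"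
  proof (rule bdd_aboveI2)
    fix vs :: "'a list" assume "vs \<in> {vs. length vs = n}"
    then show "norm (T vs) / (\<Prod>v\<leftarrow>vs. norm v) \<le> K"
      using K(2)[of vs] K(1) prod_list_norm_nonneg[of vs]
      by (cases "(\<Prod>v\<leftarrow>vs. norm v) = 0") (auto simp: divide_le_eq)
  qed
  then have *: "norm (T vs) / (\<Prod>v\<leftarrow>vs. norm v) \<le> multi_onorm n T"
    unfolding multi_onorm_def using assms(2) by (intro cSUP_upper) auto
  show ?thesis
  proof (cases "(\<Prod>v\<leftarrow>vs. norm v) = 0")
    case True then show ?thesis using K(2)[OF assms(2)] by auto
  next
    case False then show ?thesis using * prod_list_norm_nonneg[of vs] by (auto simp: divide_le_eq)
  qed
qed

lemma multi_onorm_nonneg: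
  assumes "bounded_multilinear n (T :: 'a::real_normed_vector list \<Rightarrow> _)" shows "0 \<le> multi_onorm n T"
proof -
  from assms obtain K where K: "K \<ge> 0" "\<And>vs. length vs = n \<Longrightarrow> norm (T vs) \<le> K * (\<Prod>v\<leftarrow>vs. norm v)"
    by (rule bm_bound) blast
  have "bdd_above ((\<lambda>vs. norm (T vs) / (\<Prod>v\<leftarrow>vs. norm v)) ` {vs. length vs = n})"
  proof (rule bdd_aboveI2)
    fix vs :: "'a list" assume "vs \<in> {vs. length vs = n}"
    then show "norm (T vs) / (\<Prod>v\<leftarrow>vs. norm v) \<le> K"
      using K(2)[of vs] K(1) prod_list_norm_nonneg[of vs]
      by (cases "(\<Prod>v\<leftarrow>vs. norm v) = 0") (auto simp: divide_le_eq)
  qed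
  then have *: "norm (T vs) / (\<Prod>v\<leftarrow>vs. norm v) \<le> multi_onorm n T" if "length vs = n" for vs
    unfolding multi_onorm_def using that by (intro cSUP_upper) auto
  have "0 \<le> norm (T (replicate n 0)) / (\<Prod>v\<leftarrow>(replicate n (0::'a)). norm v)"
    by (intro divide_nonneg_nonneg prod_list_norm_nonneg) auto
  also have "\<dots> \<le> multi_onorm n T" by (rule *) simp
  finally show ?thesis .
qed

lemma multi_onorm_cong: "(\<And>vs. length vs = n \<Longrightarrow> T vs = T' vs) \<Longrightarrow> multi_onorm n T = multi_onorm n T'"
  unfolding multi_onorm_def by (intro SUP_cong) auto

lemma bm_cong: "(\<And>vs. length vs = n \<Longrightarrow> T vs = T' vs) \<Longrightarrow> bounded_multilinear n T \<longleftrightarrow> bounded_multilinear n T'"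
  unfolding bounded_multilinear_def by auto

lemma multi_onorm_0: "multi_onorm 0 T = norm (T [])"
  unfolding multi_onorm_def by simp

lemma bm_0: "bounded_multilinear 0 T"
  unfolding bounded_multilinear_def by (auto intro: exI[of _ "norm (T [])"])

lemma bm_diff:
  assumes "bounded_multilinear n T" "bounded_multilinear n T'"
  shows "bounded_multilinear n (\<lambda>vs. T vs - T' vs)"
proof -
  obtain K where K: "K \<ge> 0" "\<And>vs. length vs = n \<Longrightarrow> norm (T vs) \<le> K * (\<Prod>v\<leftarrow>vs. norm v)"
    using assms(1) by (rule bm_bound) blast
  obtain K' where K': "K' \<ge> 0" "\<And>vs. length vs = n \<Longrightarrow> norm (T' vs) \<le> K' * (\<Prod>v\<leftarrow>vs. norm v)"
    using assms(2) by (rule bm_bound) blast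
  have "norm (T vs - T' vs) \<le> (K + K') * (\<Prod>v\<leftarrow>vs. norm v)" if "length vs = n" for vs
    using norm_triangle_ineq4[of "T vs" "T' vs"] K(2)[OF that] K'(2)[OF that] by (simp add: algebra_simps)
  moreover have "linear (\<lambda>v. T (vs[i := v]) - T' (vs[i := v]))" if "length vs = n" "i < n" for vs i
    using linear_compose_sub[OF bm_linear[OF assms(1) that] bm_linear[OF assms(2) that]] .
  ultimately show ?thesis unfolding bounded_multilinear_def by blast
qed

lemma bm_Cons:
  assumes "bounded_multilinear (Suc n) T"
  shows "bounded_multilinear n (\<lambda>vs. T (h # vs))"
proof -
  obtain K where K: "K \<ge> 0" "\<And>vs. length vs = Suc n \<Longrightarrow> norm (T vs) \<le> K * (\<Prod>v\<leftarrow>vs. norm v)"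
    using assms(1) by (rule bm_bound) blast
  have "norm (T (h # vs)) \<le> (K * norm h) * (\<Prod>v\<leftarrow>vs. norm v)" if "length vs = n" for vs
    using K(2)[of "h # vs"] that by (simp add: algebra_simps)
  moreover have "linear (\<lambda>v. T (h # vs[i := v]))" if "length vs = n" "i < n" for vs i
    using bm_linear[OF assms(1), of "h # vs" "Suc i"] that by simp
  ultimately show ?thesis unfolding bounded_multilinear_def by blast
qed

definition multi_uncurry :: "('a::real_normed_vector list \<Rightarrow> 'a \<Rightarrow>\<^sub>L 'b::real_normed_vector) \<Rightarrow> 'a list \<Rightarrow> 'b" where
  "multi_uncurry T vs = blinfun_apply (T (butlast vs)) (last vs)"

lemma prod_list_butlast: "length vs = Suc n \<Longrightarrow> (\<Prod>v\<leftarrow>vs. norm v) = (\<Prod>v\<leftarrow>butlast vs. norm v) * norm (last vs)"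
  for vs :: "'a::real_normed_vector list"
proof (cases vs rule: rev_cases)
  case (snoc ys y) then show ?thesis by simp
qed auto

lemma bm_unc:
  assumes "bounded_multilinear n T"
  shows "bounded_multilinear (Suc n) (multi_uncurry T)"
proof -
  obtain K where K: "K \<ge> 0" "\<And>vs. length vs = n \<Longrightarrow> norm (T vs) \<le> K * (\<Prod>v\<leftarrow>vs. norm v)"
    using assms(1) by (rule bm_bound) blast
  have "norm (multi_uncurry T vs) \<le> K * (\<Prod>v\<leftarrow>vs. norm v)" if l: "length vs = Suc n" for vs
  proof -
    have "norm (multi_uncurry T vs) \<le> norm (T (butlast vs)) * norm (last vs)"
      unfolding multi_uncurry_def by (rule norm_blinfun)
    also have "\<dots> \<le> K * (\<Prod>v\<leftarrow>butlast vs. norm v) * norm (last vs)"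
      using K(2)[of "butlast vs"] l by (intro mult_right_mono) auto
    finally show ?thesis using prod_list_butlast[OF l] by (simp add: algebra_simps)
  qed
  moreover have "linear (\<lambda>v. multi_uncurry T (vs[i := v]))" if l: "length vs = Suc n" "i < Suc n" for vs i
  proof -
    obtain ys y where vs: "vs = ys @ [y]" "length ys = n"
      using l by (cases vs rule: rev_cases) auto
    show ?thesis
    proof (cases "i = n")
      case True
      then have "(\<lambda>v. multi_uncurry T (vs[i := v])) = blinfun_apply (T ys)"
        using vs by (auto simp: multi_uncurry_def list_update_append fun_eq_iff)
      then show ?thesis by (simp add: blinfun.bounded_linear_right bounded_linear.linear)
    next
      case False
      then have *: "(\<lambda>v. multi_uncurry T (vs[i := v])) = (\<lambda>v. blinfun_apply (T (ys[i := v])) y)"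
        using vs l by (auto simp: multi_uncurry_def list_update_append fun_eq_iff)
      have "linear (\<lambda>v. T (ys[i := v]))" using bm_linear[OF assms vs(2)] False l by simp
      then show ?thesis unfolding * 
        by (auto simp: linear_iff blinfun.add_left blinfun.scaleR_left)
    qed
  qed
  ultimately show ?thesis unfolding bounded_multilinear_def by blast
qed

lemma multi_onorm_unc:
  assumes "bounded_multilinear n T"
  shows "multi_onorm (Suc n) (multi_uncurry T) = multi_onorm n T"
proof (rule antisym)
  show "multi_onorm (Suc n) (multi_uncurry T) \<le> multi_onorm n T"
  proof (rule multi_onorm_le[OF multi_onorm_nonneg[OF assms]])
    fix vs :: "'a list" assume l: "length vs = Suc n"
    have "norm (multi_uncurry T vs) \<le> norm (T (butlast vs)) * norm (last vs)"
      unfolding multi_uncurry_def by (rule norm_blinfun)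
    also have "\<dots> \<le> multi_onorm n T * (\<Prod>v\<leftarrow>butlast vs. norm v) * norm (last vs)"
      using multi_onorm_bound[OF assms, of "butlast vs"] l by (intro mult_right_mono) auto
    finally show "norm (multi_uncurry T vs) \<le> multi_onorm n T * (\<Prod>v\<leftarrow>vs. norm v)"
      using prod_list_butlast[OF l] by (simp add: algebra_simps)
  qed
  show "multi_onorm n T \<le> multi_onorm (Suc n) (multi_uncurry T)"
  proof (rule multi_onorm_le[OF multi_onorm_nonneg[OF bm_unc[OF assms]]])
    fix vs :: "'a list" assume l: "length vs = n"
    show "norm (T vs) \<le> multi_onorm (Suc n) (multi_uncurry T) * (\<Prod>v\<leftarrow>vs. norm v)"
    proof (rule norm_blinfun_bound)
      show "0 \<le> multi_onorm (Suc n) (multi_uncurry T) * (\<Prod>v\<leftarrow>vs. norm v)"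
        by (intro mult_nonneg_nonneg multi_onorm_nonneg[OF bm_unc[OF assms]] prod_list_norm_nonneg)
      fix x
      show "norm (blinfun_apply (T vs) x) \<le> multi_onorm (Suc n) (multi_uncurry T) * (\<Prod>v\<leftarrow>vs. norm v) * norm x"
        using multi_onorm_bound[OF bm_unc[OF assms], of "vs @ [x]"] l by (simp add: multi_uncurry_def algebra_simps)
    qed
  qed
qed

definition multi_curry :: "('a::real_normed_vector list \<Rightarrow> 'b::real_normed_vector) \<Rightarrow> 'a list \<Rightarrow> 'a \<Rightarrow>\<^sub>L 'b" where
  "multi_curry T vs = Blinfun (\<lambda>v. T (vs @ [v]))"

lemma cur_apply:
  assumes "bounded_multilinear (Suc n) T" "length vs = n"
  shows "blinfun_apply (multi_curry T vs) v = T (vs @ [v])"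
proof -
  obtain K where K: "K \<ge> 0" "\<And>vs. length vs = Suc n \<Longrightarrow> norm (T vs) \<le> K * (\<Prod>v\<leftarrow>vs. norm v)"
    using assms(1) by (rule bm_bound) blast
  have "linear (\<lambda>v. T (vs @ [v]))"
    using bm_linear[OF assms(1), of "vs @ [0]" n] assms(2) by (simp add: list_update_append)
  moreover have "norm (T (vs @ [v])) \<le> norm v * (K * (\<Prod>v\<leftarrow>vs. norm v))" for v
    using K(2)[of "vs @ [v]"] assms(2) by (simp add: algebra_simps)
  ultimately have "bounded_linear (\<lambda>v. T (vs @ [v]))"
    by (auto simp: linear_iff intro!: bounded_linear_intro)
  then show ?thesis unfolding multi_curry_def by (simp add: bounded_linear_Blinfun_apply)
qed

lemma bm_cur:
  assumes "bounded_multilinear (Suc n) T"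
  shows "bounded_multilinear n (multi_curry T)"
proof -
  obtain K where K: "K \<ge> 0" "\<And>vs. length vs = Suc n \<Longrightarrow> norm (T vs) \<le> K * (\<Prod>v\<leftarrow>vs. norm v)"
    using assms(1) by (rule bm_bound) blast
  have "norm (multi_curry T vs) \<le> K * (\<Prod>v\<leftarrow>vs. norm v)" if l: "length vs = n" for vs
  proof (rule norm_blinfun_bound)
    show "0 \<le> K * (\<Prod>v\<leftarrow>vs. norm v)" using K(1) by (intro mult_nonneg_nonneg prod_list_norm_nonneg)
    fix x show "norm (blinfun_apply (multi_curry T vs) x) \<le> K * (\<Prod>v\<leftarrow>vs. norm v) * norm x"
      using K(2)[of "vs @ [x]"] l by (simp add: cur_apply[OF assms] algebra_simps)
  qed
  moreover have "linear (\<lambda>v. multi_curry T (vs[i := v]))" if l: "length vs = n" "i < n" for vs i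
  proof -
    have lin: "linear (\<lambda>v. T (vs[i := v] @ [x]))" for x
      using bm_linear[OF assms, of "vs @ [x]" i] l by (simp add: list_update_append)
    show ?thesis
      using lin by (auto simp: linear_iff intro!: blinfun_eqI simp: cur_apply[OF assms] l blinfun.add_left blinfun.scaleR_left)
  qed
  ultimately show ?thesis unfolding bounded_multilinear_def by blast
qed

lemma unc_cur:
  assumes "bounded_multilinear (Suc n) T" "length vs = Suc n"
  shows "multi_uncurry (multi_curry T) vs = T vs"
  using assms by (cases vs rule: rev_cases) (auto simp: multi_uncurry_def cur_apply[OF assms(1)])

text \<open>The following two facts characterise \<^const>\<open>Ck_on\<close> by the usual recursion through
  \<open>'a \<Rightarrow>\<^sub>L 'b\<close>. As the type of \<open>f\<close> changes in it, it cannot serve as a definition.\<close>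

theorem Ck_on_0:
  fixes f :: "'a::real_normed_vector \<Rightarrow> 'b::real_normed_vector"
  shows "Ck_on 0 f S \<longleftrightarrow> continuous_on S f"
proof -
  have "(\<forall>x\<in>S. ((\<lambda>y. norm (f y - f x)) \<longlongrightarrow> 0) (at x within S)) \<longleftrightarrow> continuous_on S f"
    by (simp add: continuous_on_def tendsto_norm_zero_iff LIM_zero_iff)
  moreover have "Ck_on 0 f S \<longleftrightarrow> (\<forall>x\<in>S. ((\<lambda>y. norm (f y - f x)) \<longlongrightarrow> 0) (at x within S))"
  proof -
    have *: "((\<lambda>y. norm (D 0 y [] - D 0 x [])) \<longlongrightarrow> 0) (at x within S) \<longleftrightarrow>
        ((\<lambda>y. norm (f y - f x)) \<longlongrightarrow> 0) (at x within S)" if "\<forall>x\<in>S. D 0 x [] = f x" "x \<in> S"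
      for D :: "nat \<Rightarrow> 'a \<Rightarrow> 'a list \<Rightarrow> 'b" and x
      using that by (intro tendsto_cong) (auto simp: eventually_at_filter)
    show ?thesis
    proof
      assume "Ck_on 0 f S"
      then show "\<forall>x\<in>S. ((\<lambda>y. norm (f y - f x)) \<longlongrightarrow> 0) (at x within S)"
        unfolding Ck_on_def multi_onorm_0 using * by blast
    next
      assume "\<forall>x\<in>S. ((\<lambda>y. norm (f y - f x)) \<longlongrightarrow> 0) (at x within S)"
      then show "Ck_on 0 f S"
        unfolding Ck_on_def by (intro exI[of _ "\<lambda>i x vs. f x"]) (auto simp: multi_onorm_0 bm_0)
    qed
  qed
  ultimately show ?thesis by simp
qed

theorem Ck_on_Suc:
  fixes f :: "'a::real_normed_vector \<Rightarrow> 'b::real_normed_vector"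
  shows "Ck_on (Suc k) f S \<longleftrightarrow>
    (\<exists>f' :: 'a \<Rightarrow> 'a \<Rightarrow>\<^sub>L 'b. (\<forall>x\<in>S. (f has_derivative blinfun_apply (f' x)) (at x within S)) \<and> Ck_on k f' S)"
proof
  assume "Ck_on (Suc k) f S"
  then obtain D :: "nat \<Rightarrow> 'a \<Rightarrow> 'a list \<Rightarrow> 'b" where
    D0: "\<And>x. x \<in> S \<Longrightarrow> D 0 x [] = f x" and
    bm: "\<And>i x. i \<le> Suc k \<Longrightarrow> x \<in> S \<Longrightarrow> bounded_multilinear i (D i x)" and
    der: "\<And>i x. i < Suc k \<Longrightarrow> x \<in> S \<Longrightarrow>
       ((\<lambda>y. multi_onorm i (\<lambda>vs. D i y vs - D i x vs - D (Suc i) x ((y - x) # vs)) / norm (y - x))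
          \<longlongrightarrow> 0) (at x within S)" and
    cont: "\<And>x. x \<in> S \<Longrightarrow> ((\<lambda>y. multi_onorm (Suc k) (\<lambda>vs. D (Suc k) y vs - D (Suc k) x vs)) \<longlongrightarrow> 0) (at x within S)"
    unfolding Ck_on_def by blast
  define E where "E = (\<lambda>i x. multi_curry (D (Suc i) x))"
  have bmE: "bounded_multilinear i (E i x)" if "i \<le> k" "x \<in> S" for i x
    unfolding E_def using bm[of "Suc i" x] that by (intro bm_cur) auto
  have uncE: "multi_uncurry (E i x) vs = D (Suc i) x vs" if "i \<le> k" "x \<in> S" "length vs = Suc i" for i x vs
    unfolding E_def using bm[of "Suc i" x] that by (intro unc_cur) auto
  have "(f has_derivative blinfun_apply (E 0 x [])) (at x within S)" if x: "x \<in> S" for x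
  proof -
    have "E 0 x [] h = D 1 x [h]" for h
      unfolding E_def using cur_apply[OF bm[of "Suc 0" x], of "[]" h] x by simp
    then have "\<forall>\<^sub>F y in at x within S. multi_onorm 0 (\<lambda>vs. D 0 y vs - D 0 x vs - D (Suc 0) x ((y - x) # vs)) / norm (y - x)
       = norm (f y - f x - E 0 x [] (y - x)) / norm (y - x)"
      using D0 x by (auto simp: multi_onorm_0 eventually_at_filter)
    from tendsto_cong[OF this] der[of 0 x] x have
      "((\<lambda>y. norm (f y - f x - E 0 x [] (y - x)) / norm (y - x)) \<longlongrightarrow> 0) (at x within S)" by simp
    then show ?thesis
      by (auto simp: has_derivative_iff_norm blinfun.bounded_linear_right)
  qed
  moreover have "Ck_on k (\<lambda>x. E 0 x []) S"
    unfolding Ck_on_def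
  proof (intro exI[of _ E] conjI ballI allI impI refl)
    fix i x assume "i \<le> k" "x \<in> S" then show "bounded_multilinear i (E i x)" by (rule bmE)
  next
    fix i x assume i: "i < k" and x: "x \<in> S"
    have "multi_onorm (Suc i) (\<lambda>vs. D (Suc i) y vs - D (Suc i) x vs - D (Suc (Suc i)) x ((y - x) # vs))
        = multi_onorm i (\<lambda>vs. E i y vs - E i x vs - E (Suc i) x ((y - x) # vs))" if y: "y \<in> S" for y
    proof -
      have "bounded_multilinear i (\<lambda>vs. E i y vs - E i x vs - E (Suc i) x ((y - x) # vs))"
        using i x y by (intro bm_diff bm_Cons bmE) auto
      note multi_onorm_unc[OF this, symmetric]
      moreover have "multi_uncurry (\<lambda>vs. E i y vs - E i x vs - E (Suc i) x ((y - x) # vs)) vs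
        = D (Suc i) y vs - D (Suc i) x vs - D (Suc (Suc i)) x ((y - x) # vs)" if "length vs = Suc i" for vs
        using uncE[of i x vs] uncE[of i y vs] uncE[of "Suc i" x "(y-x) # vs"] i x y that
        by (cases vs) (auto simp: multi_uncurry_def blinfun.diff_left)
      ultimately show ?thesis by (auto intro!: multi_onorm_cong)
    qed
    then have "\<forall>\<^sub>F y in at x within S. multi_onorm (Suc i) (\<lambda>vs. D (Suc i) y vs - D (Suc i) x vs - D (Suc (Suc i)) x ((y - x) # vs)) / norm (y - x)
        = multi_onorm i (\<lambda>vs. E i y vs - E i x vs - E (Suc i) x ((y - x) # vs)) / norm (y - x)"
      by (auto simp: eventually_at_filter)
    from tendsto_cong[OF this] der[of "Suc i" x] i x
    show "((\<lambda>y. multi_onorm i (\<lambda>vs. E i y vs - E i x vs - E (Suc i) x ((y - x) # vs)) / norm (y - x)) \<longlongrightarrow> 0) (at x within S)"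
      by simp
  next
    fix x assume x: "x \<in> S"
    have "multi_onorm (Suc k) (\<lambda>vs. D (Suc k) y vs - D (Suc k) x vs)
        = multi_onorm k (\<lambda>vs. E k y vs - E k x vs)" if y: "y \<in> S" for y
    proof -
      have "bounded_multilinear k (\<lambda>vs. E k y vs - E k x vs)"
        using x y by (intro bm_diff bmE) auto
      note multi_onorm_unc[OF this, symmetric]
      moreover have "multi_uncurry (\<lambda>vs. E k y vs - E k x vs) vs
        = D (Suc k) y vs - D (Suc k) x vs" if "length vs = Suc k" for vs
        using uncE[of k x vs] uncE[of k y vs] x y that
        by (auto simp: multi_uncurry_def blinfun.diff_left)
      ultimately show ?thesis by (auto intro!: multi_onorm_cong)
    qed
    then have "\<forall>\<^sub>F y in at x within S. multi_onorm (Suc k) (\<lambda>vs. D (Suc k) y vs - D (Suc k) x vs)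
        = multi_onorm k (\<lambda>vs. E k y vs - E k x vs)"
      by (auto simp: eventually_at_filter)
    from tendsto_cong[OF this] cont[of x] x
    show "((\<lambda>y. multi_onorm k (\<lambda>vs. E k y vs - E k x vs)) \<longlongrightarrow> 0) (at x within S)"
      by simp
  qed
  ultimately show "\<exists>f' :: 'a \<Rightarrow> 'a \<Rightarrow>\<^sub>L 'b. (\<forall>x\<in>S. (f has_derivative blinfun_apply (f' x)) (at x within S)) \<and> Ck_on k f' S"
    by (intro exI[of _ "\<lambda>x. E 0 x []"]) auto
next
  assume "\<exists>f' :: 'a \<Rightarrow> 'a \<Rightarrow>\<^sub>L 'b. (\<forall>x\<in>S. (f has_derivative blinfun_apply (f' x)) (at x within S)) \<and> Ck_on k f' S"
  then obtain f' :: "'a \<Rightarrow> 'a \<Rightarrow>\<^sub>L 'b" where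
    f': "\<And>x. x \<in> S \<Longrightarrow> (f has_derivative blinfun_apply (f' x)) (at x within S)" and
    Ck: "Ck_on k f' S"
    by blast
  from Ck obtain E :: "nat \<Rightarrow> 'a \<Rightarrow> 'a list \<Rightarrow> 'a \<Rightarrow>\<^sub>L 'b" where E: "
     (\<forall>x\<in>S. E 0 x [] = f' x) \<and>
     (\<forall>i\<le>k. \<forall>x\<in>S. bounded_multilinear i (E i x)) \<and>
     (\<forall>i<k. \<forall>x\<in>S.
        ((\<lambda>y. multi_onorm i (\<lambda>vs. E i y vs - E i x vs - E (Suc i) x ((y - x) # vs)) / norm (y - x))
          \<longlongrightarrow> 0) (at x within S)) \<and>
     (\<forall>x\<in>S. ((\<lambda>y. multi_onorm k (\<lambda>vs. E k y vs - E k x vs)) \<longlongrightarrow> 0) (at x within S))"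
    unfolding Ck_on_def by (elim exE) (rule that)
  then have
    E0: "\<And>x. x \<in> S \<Longrightarrow> E 0 x [] = f' x" and
    bmE: "\<And>i x. i \<le> k \<Longrightarrow> x \<in> S \<Longrightarrow> bounded_multilinear i (E i x)" and
    der: "\<And>i x. i < k \<Longrightarrow> x \<in> S \<Longrightarrow>
       ((\<lambda>y. multi_onorm i (\<lambda>vs. E i y vs - E i x vs - E (Suc i) x ((y - x) # vs)) / norm (y - x))
          \<longlongrightarrow> 0) (at x within S)" and
    cont: "\<And>x. x \<in> S \<Longrightarrow> ((\<lambda>y. multi_onorm k (\<lambda>vs. E k y vs - E k x vs)) \<longlongrightarrow> 0) (at x within S)"
    by blast+
  define D where "D = (\<lambda>i x. case i of 0 \<Rightarrow> (\<lambda>_. f x) | Suc j \<Rightarrow> multi_uncurry (E j x))"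
  have D0: "D 0 x vs = f x" and DS: "D (Suc j) x = multi_uncurry (E j x)" for x vs j by (auto simp: D_def)
  show "Ck_on (Suc k) f S"
    unfolding Ck_on_def
  proof (intro exI[of _ D] conjI ballI allI impI)
    fix x show "D 0 x [] = f x" by (rule D0)
  next
    fix i x assume "i \<le> Suc k" "x \<in> S"
    then show "bounded_multilinear i (D i x)"
      by (cases i) (auto simp: bm_0 DS intro!: bm_unc bmE)
  next
    fix i x assume i: "i < Suc k" and x: "x \<in> S"
    show "((\<lambda>y. multi_onorm i (\<lambda>vs. D i y vs - D i x vs - D (Suc i) x ((y - x) # vs)) / norm (y - x)) \<longlongrightarrow> 0) (at x within S)"
    proof (cases i)
      case 0
      then show ?thesis using f'[OF x] x
        by (simp add: has_derivative_iff_norm multi_onorm_0 D0 DS multi_uncurry_def E0)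
    next
      case (Suc j)
      have "multi_onorm i (\<lambda>vs. D i y vs - D i x vs - D (Suc i) x ((y - x) # vs))
        = multi_onorm j (\<lambda>vs. E j y vs - E j x vs - E (Suc j) x ((y - x) # vs))" if y: "y \<in> S" for y
      proof -
        have "bounded_multilinear j (\<lambda>vs. E j y vs - E j x vs - E (Suc j) x ((y - x) # vs))"
          using i Suc x y by (intro bm_diff bm_Cons bmE) auto
        note multi_onorm_unc[OF this, symmetric]
        then show ?thesis unfolding Suc
          by (auto intro!: multi_onorm_cong simp: DS multi_uncurry_def blinfun.diff_left)
      qed
      then have "\<forall>\<^sub>F y in at x within S. multi_onorm i (\<lambda>vs. D i y vs - D i x vs - D (Suc i) x ((y - x) # vs)) / norm (y - x)
        = multi_onorm j (\<lambda>vs. E j y vs - E j x vs - E (Suc j) x ((y - x) # vs)) / norm (y - x)"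
        by (auto simp: eventually_at_filter)
      from tendsto_cong[OF this] der[of j x] i x Suc show ?thesis by simp
    qed
  next
    fix x assume x: "x \<in> S"
    have "multi_onorm (Suc k) (\<lambda>vs. D (Suc k) y vs - D (Suc k) x vs)
        = multi_onorm k (\<lambda>vs. E k y vs - E k x vs)" if y: "y \<in> S" for y
    proof -
      have "bounded_multilinear k (\<lambda>vs. E k y vs - E k x vs)"
        using x y by (intro bm_diff bmE) auto
      note multi_onorm_unc[OF this, symmetric]
      then show ?thesis
        by (auto intro!: multi_onorm_cong simp: DS multi_uncurry_def blinfun.diff_left)
    qed
    then have "\<forall>\<^sub>F y in at x within S. multi_onorm (Suc k) (\<lambda>vs. D (Suc k) y vs - D (Suc k) x vs)
        = multi_onorm k (\<lambda>vs. E k y vs - E k x vs)"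
      by (auto simp: eventually_at_filter)
    from tendsto_cong[OF this] cont[OF x]
    show "((\<lambda>y. multi_onorm (Suc k) (\<lambda>vs. D (Suc k) y vs - D (Suc k) x vs)) \<longlongrightarrow> 0) (at x within S)"
      by simp
  qed
qed

end

theory Submission
  imports Defs "HOL-Probability.Discrete_Topology"
begin

text \<open>
  On a small ball around \<open>u\<^sub>0\<close> the functionals \<open>J(\<cdot>, \<mu>)\<close> are uniformly strongly convex, and the
  gradient at the centre is small for \<open>\<mu>\<close> near \<open>\<mu>\<^sub>0\<close>. Minimizing sequences of strongly convex functions
  are Cauchy, and the minimizer on the closed ball lies in the interior; strong monotonicity
  of the gradient makes it the only critical point and continuous in \<open>\<mu>\<close>. Comparing the minimizers at two
  parameters gives the envelope formula \<open>J\<^sub>*' = \<partial>\<^sub>MJ(u(\<mu>), \<mu>)\<close> from \<open>J \<in> C\<^sup>1\<close> alone. For \<open>k \<ge> 2\<close>, the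
  implicit function theorem for \<open>\<partial>\<^sub>XJ(u(\<mu>), \<mu>) = 0\<close> yields \<open>u \<in> C\<^sup>k\<^sup>-\<^sup>1\<close>, so that \<open>J\<^sub>*' \<in> C\<^sup>k\<^sup>-\<^sup>1\<close> by the
  chain rule.
\<close>

section \<open>Calculus of \<open>C\<^sup>k\<close> maps\<close>

text \<open>When \<open>k = 1\<close>, no joint derivative of the gradient in \<open>w\<close> is
  given, so \<open>u\<close> cannot be expected to be differentiable and the formula for the
  derivative of the value function cannot come from the chain rule. When \<open>k >= 2\<close>,
  composing \<open>J\<close> with the \<open>C^(k-1)\<close> map \<open>u\<close> would lose one
  derivative. It is regained because the formula contains \<open>u\<close> but not the derivative of
  \<open>u\<close>, hence is a composition of \<open>C^(k-1)\<close> maps. The space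
  \<open>X\<close> carries no inner product and is not assumed reflexive. Completeness takes over
  both roles: it yields minimizers without weak compactness, and it closes the range of the Hessian.
  That the Hessian maps onto the dual space is then read off from the solvability of perturbed
  minimization problems. A further obstacle is one of types: each differentiation changes the type
  of the map, so the product and chain rules admit no naive induction on \<open>k\<close>.\<close>

lemma Ck_onE:
  assumes "Ck_on k f S"
  obtains D where "\<And>x. x \<in> S \<Longrightarrow> D 0 x [] = f x"
    "\<And>i x. i \<le> k \<Longrightarrow> x \<in> S \<Longrightarrow> bounded_multilinear i (D i x)"
    "\<And>i x. i < k \<Longrightarrow> x \<in> S \<Longrightarrow>
      ((\<lambda>y. multi_onorm i (\<lambda>vs. D i y vs - D i x vs - D (Suc i) x ((y - x) # vs)) / norm (y - x))
        \<longlongrightarrow> 0) (at x within S)"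
    "\<And>x. x \<in> S \<Longrightarrow> ((\<lambda>y. multi_onorm k (\<lambda>vs. D k y vs - D k x vs)) \<longlongrightarrow> 0) (at x within S)"
proof -
  from assms[unfolded Ck_on_def] show ?thesis
  proof (elim exE conjE, goal_cases)
    case (1 D)
    then show ?case by (intro that[of D]) simp_all
  qed
qed

lemma Ck_on_cong:
  assumes "\<And>x. x \<in> S \<Longrightarrow> f x = g x"
  shows "Ck_on k f S \<longleftrightarrow> Ck_on k g S"
  using assms unfolding Ck_on_def by simp

lemma bm_add:
  assumes "bounded_multilinear n T" "bounded_multilinear n T'"
  shows "bounded_multilinear n (\<lambda>vs. T vs + T' vs)"
    and "multi_onorm n (\<lambda>vs. T vs + T' vs) \<le> multi_onorm n T + multi_onorm n T'"
proof -
  have *: "norm (T vs + T' vs) \<le> (multi_onorm n T + multi_onorm n T') * (\<Prod>v\<leftarrow>vs. norm v)"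
    if "length vs = n" for vs
    using norm_triangle_ineq[of "T vs" "T' vs"] multi_onorm_bound[OF assms(1) that]
      multi_onorm_bound[OF assms(2) that] by (simp add: algebra_simps)
  show "bounded_multilinear n (\<lambda>vs. T vs + T' vs)"
    unfolding bounded_multilinear_def
    using * linear_compose_add[OF bm_linear[OF assms(1)] bm_linear[OF assms(2)]] by blast
  show "multi_onorm n (\<lambda>vs. T vs + T' vs) \<le> multi_onorm n T + multi_onorm n T'"
    using * by (intro multi_onorm_le add_nonneg_nonneg multi_onorm_nonneg assms)
qed

lemma null_comparison_within:
  fixes g :: "'a::topological_space \<Rightarrow> real"
  assumes "(g \<longlongrightarrow> 0) (at x within S)" "\<And>y. y \<in> S \<Longrightarrow> y \<noteq> x \<Longrightarrow> norm (f y) \<le> g y"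
  shows "(f \<longlongrightarrow> 0) (at x within S)"
  by (rule Lim_null_comparison[OF _ assms(1)]) (simp add: eventually_at_filter assms(2))

text \<open>Proved on the whole family of derivatives at once: an induction on \<open>k\<close>
  through \<open>Ck_on_Suc\<close> would have to change the type of \<open>f\<close>.\<close>

lemma Ck_on_add:
  assumes "Ck_on k f S" "Ck_on k g S"
  shows "Ck_on k (\<lambda>x. f x + g x) S"
proof -
  obtain D where D: "\<And>x. x \<in> S \<Longrightarrow> D 0 x [] = f x"
    "\<And>i x. i \<le> k \<Longrightarrow> x \<in> S \<Longrightarrow> bounded_multilinear i (D i x)"
    "\<And>i x. i < k \<Longrightarrow> x \<in> S \<Longrightarrow>
      ((\<lambda>y. multi_onorm i (\<lambda>vs. D i y vs - D i x vs - D (Suc i) x ((y - x) # vs)) / norm (y - x))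
        \<longlongrightarrow> 0) (at x within S)"
    "\<And>x. x \<in> S \<Longrightarrow> ((\<lambda>y. multi_onorm k (\<lambda>vs. D k y vs - D k x vs)) \<longlongrightarrow> 0) (at x within S)"
    by (rule Ck_onE[OF assms(1)]) (rule that)
  obtain E where E: "\<And>x. x \<in> S \<Longrightarrow> E 0 x [] = g x"
    "\<And>i x. i \<le> k \<Longrightarrow> x \<in> S \<Longrightarrow> bounded_multilinear i (E i x)"
    "\<And>i x. i < k \<Longrightarrow> x \<in> S \<Longrightarrow>
      ((\<lambda>y. multi_onorm i (\<lambda>vs. E i y vs - E i x vs - E (Suc i) x ((y - x) # vs)) / norm (y - x))
        \<longlongrightarrow> 0) (at x within S)"
    "\<And>x. x \<in> S \<Longrightarrow> ((\<lambda>y. multi_onorm k (\<lambda>vs. E k y vs - E k x vs)) \<longlongrightarrow> 0) (at x within S)"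
    by (rule Ck_onE[OF assms(2)]) (rule that)
  define H where "H i x vs = D i x vs + E i x vs" for i x vs
  have bmH: "bounded_multilinear i (H i x)" if "i \<le> k" "x \<in> S" for i x
    unfolding H_def using that by (intro bm_add D E)
  show ?thesis
    unfolding Ck_on_def
  proof (intro exI[of _ H] conjI ballI allI impI)
    fix x assume "x \<in> S" then show "H 0 x [] = f x + g x" by (simp add: H_def D E)
  next
    fix i x assume "i \<le> k" "x \<in> S" then show "bounded_multilinear i (H i x)" by (rule bmH)
  next
    fix i x assume i: "i < k" and x: "x \<in> S"
    let ?r = "\<lambda>D y. multi_onorm i (\<lambda>vs. D i y vs - D i x vs - D (Suc i) x ((y - x) # vs))"
    have le: "norm (?r H y / norm (y - x)) \<le> ?r D y / norm (y - x) + ?r E y / norm (y - x)"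
      if y: "y \<in> S" for y
    proof -
      have bm: "bounded_multilinear i (\<lambda>vs. D i y vs - D i x vs - D (Suc i) x ((y - x) # vs))"
        "bounded_multilinear i (\<lambda>vs. E i y vs - E i x vs - E (Suc i) x ((y - x) # vs))"
        "bounded_multilinear i (\<lambda>vs. H i y vs - H i x vs - H (Suc i) x ((y - x) # vs))"
        using i x y by (intro bm_diff bm_Cons D E bmH; simp)+
      have "?r H y \<le> ?r D y + ?r E y"
        using bm_add(2)[OF bm(1,2)] by (simp add: H_def algebra_simps)
      then show ?thesis
        using multi_onorm_nonneg[OF bm(3)] by (simp add: add_divide_distrib[symmetric] divide_right_mono)
    qed
    show "((\<lambda>y. ?r H y / norm (y - x)) \<longlongrightarrow> 0) (at x within S)"
      using tendsto_add[OF D(3) E(3), OF i x i x]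
      by (intro null_comparison_within[OF _ le]) simp_all
  next
    fix x assume x: "x \<in> S"
    let ?r = "\<lambda>D y. multi_onorm k (\<lambda>vs. D k y vs - D k x vs)"
    have le: "norm (?r H y) \<le> ?r D y + ?r E y" if y: "y \<in> S" for y
    proof -
      have bm: "bounded_multilinear k (\<lambda>vs. D k y vs - D k x vs)"
        "bounded_multilinear k (\<lambda>vs. E k y vs - E k x vs)"
        "bounded_multilinear k (\<lambda>vs. H k y vs - H k x vs)"
        using x y by (intro bm_diff bm_Cons D E bmH; simp)+
      have "?r H y \<le> ?r D y + ?r E y"
        using bm_add(2)[OF bm(1,2)] by (simp add: H_def algebra_simps)
      then show ?thesis
        using multi_onorm_nonneg[OF bm(3)] by simp
    qed
    show "((\<lambda>y. ?r H y) \<longlongrightarrow> 0) (at x within S)"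
      using tendsto_add[OF D(4) E(4), OF x x]
      by (intro null_comparison_within[OF _ le]) simp_all
  qed
qed

text \<open>Differentiability of \<open>D k\<close> makes it continuous: its increment is the
  remainder plus \<open>D (Suc k) x\<close> in the direction \<open>y - x\<close>, and both vanish
  in the limit.\<close>

lemma Ck_on_Suc_imp:
  assumes "Ck_on (Suc k) f S"
  shows "Ck_on k f S"
proof -
  obtain D where D: "\<And>x. x \<in> S \<Longrightarrow> D 0 x [] = f x"
    "\<And>i x. i \<le> Suc k \<Longrightarrow> x \<in> S \<Longrightarrow> bounded_multilinear i (D i x)"
    "\<And>i x. i < Suc k \<Longrightarrow> x \<in> S \<Longrightarrow>
      ((\<lambda>y. multi_onorm i (\<lambda>vs. D i y vs - D i x vs - D (Suc i) x ((y - x) # vs)) / norm (y - x))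
        \<longlongrightarrow> 0) (at x within S)"
    by (rule Ck_onE[OF assms]) (rule that)
  have "((\<lambda>y. multi_onorm k (\<lambda>vs. D k y vs - D k x vs)) \<longlongrightarrow> 0) (at x within S)" if x: "x \<in> S" for x
  proof -
    let ?r = "\<lambda>y. multi_onorm k (\<lambda>vs. D k y vs - D k x vs - D (Suc k) x ((y - x) # vs))"
    let ?M = "multi_onorm (Suc k) (D (Suc k) x)"
    have M: "?M \<ge> 0" using D(2)[of "Suc k" x] x by (intro multi_onorm_nonneg) auto
    have le: "norm (multi_onorm k (\<lambda>vs. D k y vs - D k x vs)) \<le> ?r y / norm (y - x) * norm (y - x) + ?M * norm (y - x)"
      if y: "y \<in> S" "y \<noteq> x" for y
    proof -
      have bm: "bounded_multilinear k (\<lambda>vs. D k y vs - D k x vs - D (Suc k) x ((y - x) # vs))"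
        "bounded_multilinear k (\<lambda>vs. D (Suc k) x ((y - x) # vs))"
        "bounded_multilinear k (\<lambda>vs. D k y vs - D k x vs)"
        using x y by (intro bm_diff bm_Cons D; simp)+
      have "multi_onorm k (\<lambda>vs. D (Suc k) x ((y - x) # vs)) \<le> ?M * norm (y - x)"
        using multi_onorm_bound[OF D(2)[of "Suc k" x], of "(y - x) # _"] x M
        by (intro multi_onorm_le) (auto simp: mult.assoc)
      then show ?thesis using bm_add(2)[OF bm(1,2)] multi_onorm_nonneg[OF bm(3)] y by simp
    qed
    have "((\<lambda>y. norm (y - x)) \<longlongrightarrow> 0) (at x within S)"
      by (rule tendsto_norm_zero) (simp add: LIM_zero_iff)
    from tendsto_add[OF tendsto_mult[OF D(3)[OF lessI x] this] tendsto_mult_left[OF this, of ?M]]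
    have lim: "((\<lambda>y. ?r y / norm (y - x) * norm (y - x) + ?M * norm (y - x)) \<longlongrightarrow> 0) (at x within S)"
      by (simp only: mult_zero_right add_0)
    show ?thesis
      by (rule null_comparison_within[OF lim le])
  qed
  with D show ?thesis unfolding Ck_on_def by (intro exI[of _ D]) auto
qed

lemma Ck_on_mono:
  assumes "Ck_on k f S" "j \<le> k"
  shows "Ck_on j f S"
  using assms(2,1) by (induction rule: dec_induct) (auto dest: Ck_on_Suc_imp)

lemma Ck_on_const:
  fixes c :: "'b::real_normed_vector" and S :: "'a::real_normed_vector set"
  shows "Ck_on k (\<lambda>x. c) S"
proof -
  have "multi_onorm i (\<lambda>vs :: 'a list. 0 :: 'b) = 0" for i
    by (intro antisym multi_onorm_le multi_onorm_nonneg) (auto simp: bounded_multilinear_def module_hom_zero intro: exI[of _ 0])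
  then show ?thesis
    unfolding Ck_on_def
    by (intro exI[of _ "\<lambda>i x vs. if i = 0 then c else 0"])
      (auto simp: bm_0 bounded_multilinear_def module_hom_zero intro: exI[of _ 0])
qed

lemma Ck_on_id: "Ck_on k (\<lambda>x. x) S"
proof (cases k)
  case 0
  then show ?thesis by (simp add: Ck_on_0)
next
  case (Suc j)
  then show ?thesis
    unfolding Suc Ck_on_Suc by (intro exI[of _ "\<lambda>x. id_blinfun"]) (auto simp: Ck_on_const)
qed

text \<open>Only linearity on a closed subspace is demanded, so that this also applies to the inverse
  of an embedding, which has no continuous linear extension in general.\<close>

lemma Ck_on_linear_image:
  assumes "Ck_on k f S" "open S" "subspace V" "closed V" "f ` S \<subseteq> V"
    and P_add: "\<And>a b. a \<in> V \<Longrightarrow> b \<in> V \<Longrightarrow> P (a + b) = P a + P b"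
    and P_scale: "\<And>r a. a \<in> V \<Longrightarrow> P (r *\<^sub>R a) = r *\<^sub>R P a"
    and P_bound: "\<And>a. a \<in> V \<Longrightarrow> norm (P a) \<le> K * norm a" and "K \<ge> 0"
  shows "Ck_on k (\<lambda>x. P (f x)) S"
proof -
  have P_diff: "P (a - b) = P a - P b" if "a \<in> V" "b \<in> V" for a b
    using P_add[OF that(1) subspace_neg[OF assms(3) that(2)]] P_scale[OF that(2), of "-1"] by simp
  obtain D where D: "\<And>x. x \<in> S \<Longrightarrow> D 0 x [] = f x"
    "\<And>i x. i \<le> k \<Longrightarrow> x \<in> S \<Longrightarrow> bounded_multilinear i (D i x)"
    "\<And>i x. i < k \<Longrightarrow> x \<in> S \<Longrightarrow>
      ((\<lambda>y. multi_onorm i (\<lambda>vs. D i y vs - D i x vs - D (Suc i) x ((y - x) # vs)) / norm (y - x))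
        \<longlongrightarrow> 0) (at x within S)"
    "\<And>x. x \<in> S \<Longrightarrow> ((\<lambda>y. multi_onorm k (\<lambda>vs. D k y vs - D k x vs)) \<longlongrightarrow> 0) (at x within S)"
    by (rule Ck_onE[OF assms(1)]) (rule that)
  \<comment> \<open>The derivatives stay in \<open>V\<close>: on \<open>h # ws\<close> the next one
    is a limit of difference quotients lying in \<open>V\<close>, and \<open>V\<close> is
    closed.\<close>
  have DV: "D i x vs \<in> V" if "i \<le> k" "x \<in> S" "length vs = i" for i x vs
    using that
  proof (induction i arbitrary: x vs)
    case 0
    then show ?case using D(1) assms(5) by auto
  next
    case (Suc i)
    then obtain h ws where vs: "vs = h # ws" and ws: "length ws = i" by (cases vs) auto
    have lin: "linear (\<lambda>v. D (Suc i) x (v # ws))"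
      using bm_linear[OF D(2)[OF Suc.prems(1,2)], of "h # ws" 0] ws by simp
    \<comment> \<open>A zero direction is treated separately, because
      \<open>x + t *\<^sub>R h\<close> must approach \<open>x\<close> through points different from
      \<open>x\<close>.\<close>
    show ?case
    proof (cases "h = 0")
      case True
      then show ?thesis using linear_0[OF lin] subspace_0[OF assms(3)] by (simp add: vs)
    next
      case False
      let ?r = "\<lambda>y. multi_onorm i (\<lambda>vs. D i y vs - D i x vs - D (Suc i) x ((y - x) # vs)) / norm (y - x)"
      let ?q = "\<lambda>t. (D i (x + t *\<^sub>R h) ws - D i x ws) /\<^sub>R t"
      have "(\<lambda>t. x + t *\<^sub>R h) \<midarrow>0\<rightarrow> x + 0 *\<^sub>R h"
        by (intro tendsto_intros)
      then have tends: "(\<lambda>t. x + t *\<^sub>R h) \<midarrow>0\<rightarrow> x" by simp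
      have evS: "\<forall>\<^sub>F t in at 0. x + t *\<^sub>R h \<in> S"
        using topological_tendstoD[OF tends assms(2) Suc.prems(2)] .
      then have "filterlim (\<lambda>t. x + t *\<^sub>R h) (at x within S) (at 0)"
        using tends False unfolding filterlim_at
        by (auto simp: eventually_at_filter elim: eventually_mono)
      from filterlim_compose[OF D(3)[of i x] this] Suc.prems
      have "((\<lambda>t. ?r (x + t *\<^sub>R h)) \<longlongrightarrow> 0) (at 0)" by simp
      from tendsto_mult_left_zero[OF this, of "norm h * (\<Prod>v\<leftarrow>ws. norm v)"]
      have lim: "((\<lambda>t. ?r (x + t *\<^sub>R h) * (norm h * (\<Prod>v\<leftarrow>ws. norm v))) \<longlongrightarrow> 0) (at 0)" .
      have "norm (?q t - D (Suc i) x vs) \<le> ?r (x + t *\<^sub>R h) * (norm h * (\<Prod>v\<leftarrow>ws. norm v))"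
        if t: "x + t *\<^sub>R h \<in> S" "t \<noteq> 0" for t
      proof -
        have bm: "bounded_multilinear i (\<lambda>vs. D i (x + t *\<^sub>R h) vs - D i x vs - D (Suc i) x ((x + t *\<^sub>R h - x) # vs))"
          using Suc.prems t by (intro bm_diff bm_Cons D; simp)
        have "?q t - D (Suc i) x vs = (D i (x + t *\<^sub>R h) ws - D i x ws - D (Suc i) x ((t *\<^sub>R h) # ws)) /\<^sub>R t"
          using t linear_scale[OF lin, of t h] by (simp add: vs scaleR_diff_right)
        then have "norm (?q t - D (Suc i) x vs)
            = norm (D i (x + t *\<^sub>R h) ws - D i x ws - D (Suc i) x ((t *\<^sub>R h) # ws)) / \<bar>t\<bar>"
          by (simp add: divide_inverse_commute)
        then show ?thesis
          using divide_right_mono[OF multi_onorm_bound[OF bm ws], of "\<bar>t\<bar>"] t False by simp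
      qed
      then have "((\<lambda>t. ?q t - D (Suc i) x vs) \<longlongrightarrow> 0) (at 0)"
        using evS by (intro Lim_null_comparison[OF _ lim]) (auto simp: eventually_at_filter elim: eventually_mono)
      then have q_lim: "(?q \<longlongrightarrow> D (Suc i) x vs) (at 0)" by (simp add: LIM_zero_iff)
      have "\<forall>\<^sub>F t in at 0. ?q t \<in> V"
        using evS by eventually_elim
          (use Suc ws in \<open>auto intro!: subspace_scale subspace_diff assms\<close>)
      from Lim_in_closed_set[OF assms(4) this at_neq_bot q_lim] show ?thesis .
    qed
  qed
  have bmP: "bounded_multilinear i (\<lambda>vs. P (T vs))"
    and P_onorm: "multi_onorm i (\<lambda>vs. P (T vs)) \<le> K * multi_onorm i T"
    if T: "bounded_multilinear i T" "\<And>vs. length vs = i \<Longrightarrow> T vs \<in> V" for i T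
  proof -
    have *: "norm (P (T vs)) \<le> (K * multi_onorm i T) * (\<Prod>v\<leftarrow>vs. norm v)" if "length vs = i" for vs
      using P_bound[OF T(2)[OF that]] mult_left_mono[OF multi_onorm_bound[OF T(1) that] \<open>K \<ge> 0\<close>]
      by (simp add: mult.assoc)
    moreover have "linear (\<lambda>v. P (T (vs[j := v])))" if "length vs = i" "j < i" for vs j
      using bm_linear[OF T(1) that] T(2)[of "vs[j := _]"] that
      by (auto simp: linear_iff P_add P_scale)
    ultimately show "bounded_multilinear i (\<lambda>vs. P (T vs))"
      unfolding bounded_multilinear_def by blast
    show "multi_onorm i (\<lambda>vs. P (T vs)) \<le> K * multi_onorm i T"
      using * by (intro multi_onorm_le mult_nonneg_nonneg multi_onorm_nonneg T \<open>K \<ge> 0\<close>)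
  qed
  define E where "E i x vs = P (D i x vs)" for i x vs
  have bmE: "bounded_multilinear i (E i x)" if "i \<le> k" "x \<in> S" for i x
    unfolding E_def using that by (intro bmP D DV)
  show ?thesis
    unfolding Ck_on_def
  proof (intro exI[of _ E] conjI ballI allI impI)
    fix x assume "x \<in> S" then show "E 0 x [] = P (f x)" by (simp add: E_def D)
  next
    fix i x assume "i \<le> k" "x \<in> S" then show "bounded_multilinear i (E i x)" by (rule bmE)
  next
    fix i x assume i: "i < k" and x: "x \<in> S"
    let ?r = "\<lambda>D y. multi_onorm i (\<lambda>vs. D i y vs - D i x vs - D (Suc i) x ((y - x) # vs))"
    have le: "norm (?r E y / norm (y - x)) \<le> K * (?r D y / norm (y - x))"
      if y: "y \<in> S" for y
    proof -
      let ?T = "\<lambda>vs. D i y vs - D i x vs - D (Suc i) x ((y - x) # vs)"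
      have bm: "bounded_multilinear i ?T"
        "bounded_multilinear i (\<lambda>vs. E i y vs - E i x vs - E (Suc i) x ((y - x) # vs))"
        using i x y by (intro bm_diff bm_Cons D bmE; simp)+
      have TV: "?T vs \<in> V" if "length vs = i" for vs
        using that i x y by (intro subspace_diff assms DV) auto
      have "?r E y = multi_onorm i (\<lambda>vs. P (?T vs))"
        unfolding E_def using i x y
        by (intro multi_onorm_cong) (simp add: P_diff DV subspace_diff[OF assms(3)])
      also have "\<dots> \<le> K * ?r D y" by (rule P_onorm[OF bm(1) TV])
      finally show ?thesis
        using multi_onorm_nonneg[OF bm(2)] by (simp add: divide_right_mono)
    qed
    show "((\<lambda>y. ?r E y / norm (y - x)) \<longlongrightarrow> 0) (at x within S)"
      by (rule null_comparison_within[OF tendsto_mult_right_zero[OF D(3)[OF i x], of K] le])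
  next
    fix x assume x: "x \<in> S"
    let ?r = "\<lambda>D y. multi_onorm k (\<lambda>vs. D k y vs - D k x vs)"
    have le: "norm (?r E y) \<le> K * ?r D y" if y: "y \<in> S" for y
    proof -
      let ?T = "\<lambda>vs. D k y vs - D k x vs"
      have bm: "bounded_multilinear k ?T"
        "bounded_multilinear k (\<lambda>vs. E k y vs - E k x vs)"
        using x y by (intro bm_diff bm_Cons D bmE; simp)+
      have TV: "?T vs \<in> V" if "length vs = k" for vs
        using that x y by (intro subspace_diff assms DV) auto
      have "?r E y = multi_onorm k (\<lambda>vs. P (?T vs))"
        unfolding E_def using x y
        by (intro multi_onorm_cong) (simp add: P_diff DV)
      also have "\<dots> \<le> K * ?r D y" by (rule P_onorm[OF bm(1) TV])
      finally show ?thesis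
        using multi_onorm_nonneg[OF bm(2)] by simp
    qed
    show "((\<lambda>y. ?r E y) \<longlongrightarrow> 0) (at x within S)"
      by (rule null_comparison_within[OF tendsto_mult_right_zero[OF D(4)[OF x], of K] le])
  qed
qed

lemma Ck_on_bounded_linear:
  assumes "bounded_linear L" "open S" "Ck_on k f S"
  shows "Ck_on k (\<lambda>x. L (f x)) S"
proof -
  obtain K where "K \<ge> 0" "\<And>x. norm (L x) \<le> K * norm x"
    using bounded_linear.nonneg_bounded[OF assms(1)] by (auto simp: mult.commute)
  then show ?thesis
    by (intro Ck_on_linear_image[OF assms(3,2), where V = UNIV and K = K])
      (simp_all add: linear_add linear_scale bounded_linear.linear[OF assms(1)])
qed

text \<open>Since \<open>'b\<close> is complete, the range of \<open>L\<close> is complete, hence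
  closed, and \<open>inv L\<close> is linear on it with bound 1. Regularity can thus be tested after
  an embedding into a fixed space.\<close>

lemma Ck_on_embedding_iff:
  fixes L :: "'b::banach \<Rightarrow> 'c::real_normed_vector"
  assumes L: "bounded_linear L" "\<And>a. norm a \<le> norm (L a)" and "open S"
  shows "Ck_on k (\<lambda>x. L (f x)) S \<longleftrightarrow> Ck_on k f S"
proof
  assume *: "Ck_on k (\<lambda>x. L (f x)) S"
  interpret L: bounded_linear L by fact
  have inj: "inj L"
    using L(2) by (intro injI) (metis L.diff eq_iff_diff_eq_0 norm_le_zero_iff norm_zero)
  have "complete (range L)"
    using complete_isometric_image[of 1 UNIV L] L by (auto simp: complete_UNIV)
  moreover have "subspace (range L)"
    by (simp add: L.linear_axioms linear_subspace_image)
  ultimately have "Ck_on k (\<lambda>x. inv L (L (f x))) S"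
    using inj L(2) by (intro Ck_on_linear_image[OF * \<open>open S\<close>, where V = "range L" and K = 1])
      (auto simp: complete_imp_closed L.add[symmetric] L.scaleR[symmetric])
  then show "Ck_on k f S" using inj by simp
qed (rule Ck_on_bounded_linear[OF L(1) \<open>open S\<close>])

lemma Ck_on_Pair:
  assumes "Ck_on k f S" "Ck_on k g S" "open S"
  shows "Ck_on k (\<lambda>x. (f x, g x)) S"
proof -
  have "Ck_on k (\<lambda>x. (f x, 0) + (0, g x)) S"
    by (intro Ck_on_add Ck_on_bounded_linear[OF _ assms(3,1), where L = "\<lambda>a. (a, 0)"]
        Ck_on_bounded_linear[OF _ assms(3,2), where L = "\<lambda>a. (0, a)"]
        bounded_linear_Pair bounded_linear_ident bounded_linear_zero)
  then show ?thesis by simp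
qed

section \<open>Product and chain rule\<close>

lemma continuous_on_discrete: "continuous_on (S :: 'a discrete set) f"
  unfolding continuous_on_topological
proof (intro ballI allI impI)
  fix x B assume "open B" "f x \<in> B"
  then show "\<exists>A. open A \<and> x \<in> A \<and> (\<forall>y\<in>S. y \<in> A \<longrightarrow> f y \<in> B)"
    by (intro exI[of _ "{x}"]) (simp add: open_discrete)
qed

text \<open>
  Induction on \<open>k\<close> through \<open>Ck_on_Suc\<close> changes the type of the map. To stay within one type, derivatives
  are encoded as bounded functions on lists of vectors: this space contains the bounded linear
  maps into itself isometrically (\<open>jet_cons\<close> below). The discrete topology makes continuity vacuous.
\<close>

type_synonym ('e, 'b) jet = "'e list discrete \<Rightarrow>\<^sub>C 'b"

text \<open>Applying \<open>Ck_on_embedding_iff\<close> to \<open>jet_cons\<close> requires the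
  operators into jets to form a Banach space.\<close>

instance bcontfun :: (metric_space, banach) banach ..

text \<open>Meaningful for bounded \<open>F\<close> only; evaluations therefore go through
  \<open>jet_apply_jet\<close> with an explicit bound.\<close>

definition jet :: "('e list \<Rightarrow> 'b::metric_space) \<Rightarrow> ('e, 'b) jet" where
  "jet F = Bcontfun (\<lambda>d. F (of_discrete d))"

definition jet_apply :: "('e, 'b::metric_space) jet \<Rightarrow> 'e list \<Rightarrow> 'b" where
  "jet_apply \<phi> vs = apply_bcontfun \<phi> (discrete vs)"

lemma jet_apply_jet:
  fixes F :: "'e list \<Rightarrow> 'b::real_normed_vector"
  assumes "\<And>vs. norm (F vs) \<le> K"
  shows "jet_apply (jet F) vs = F vs"
proof -
  have "(\<lambda>d. F (of_discrete d)) \<in> bcontfun"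
    using assms by (intro bcontfun_normI continuous_on_discrete)
  then show ?thesis
    by (simp add: jet_apply_def jet_def Bcontfun_inverse discrete_inverse)
qed

lemma jet_eqI: "(\<And>vs. jet_apply \<phi> vs = jet_apply \<psi> vs) \<Longrightarrow> \<phi> = \<psi>"
  unfolding jet_apply_def by (metis bcontfun_eqI of_discrete_inverse)

lemma norm_jet_apply_le: "norm (jet_apply \<phi> vs) \<le> norm \<phi>"
  unfolding jet_apply_def by (rule norm_bounded)

lemma norm_jet_le: "(\<And>vs. norm (jet_apply \<phi> vs) \<le> K) \<Longrightarrow> norm \<phi> \<le> K"
  unfolding jet_apply_def by (metis norm_bound of_discrete_inverse)

lemma bounded_linear_jet_apply: "bounded_linear (\<lambda>\<phi>. jet_apply \<phi> vs)"
  by (rule bounded_linear_intro[where K = 1])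
    (simp_all add: norm_jet_apply_le, simp_all add: jet_apply_def)

lemmas jet_apply_add = linear_add[OF bounded_linear.linear[OF bounded_linear_jet_apply]]
  and jet_apply_scaleR = linear_scale[OF bounded_linear.linear[OF bounded_linear_jet_apply]]

text \<open>An isometric copy of \<open>'b\<close> among the jets, through which results on
  jet-valued maps descend to ordinary maps.\<close>

definition jet_const :: "'b::metric_space \<Rightarrow> ('e, 'b) jet" where
  "jet_const b = jet (\<lambda>vs. b)"

lemma jet_apply_const: "jet_apply (jet_const b) vs = b" for b :: "'b::real_normed_vector"
  unfolding jet_const_def by (rule jet_apply_jet) (rule order_refl)

lemma bounded_linear_jet_const:
  "bounded_linear (jet_const :: 'b::real_normed_vector \<Rightarrow> ('e, 'b) jet)"
  by (rule bounded_linear_intro[where K = 1])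
    (auto intro!: jet_eqI norm_jet_le simp: jet_apply_const jet_apply_add jet_apply_scaleR)

lemma norm_jet_const: "norm b \<le> norm (jet_const b :: ('e, 'b::real_normed_vector) jet)"
  using norm_jet_apply_le[of "jet_const b"] by (simp add: jet_apply_const)

text \<open>A nonzero operator is unbounded as a function of \<open>v\<close>, so only its values on
  unit vectors are stored. By homogeneity they determine it, and the encoding is isometric. The
  value 0 on the empty list keeps it linear.\<close>

definition jet_cons ::
  "('e::real_normed_vector \<Rightarrow>\<^sub>L ('e, 'b::real_normed_vector) jet) \<Rightarrow> ('e, 'b) jet" where
  "jet_cons T = jet (\<lambda>vs. case vs of [] \<Rightarrow> 0 | v # ws \<Rightarrow> jet_apply (T (sgn v)) ws)"

lemma norm_blinfun_sgn_le: "norm (blinfun_apply T (sgn v)) \<le> norm T"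
  using norm_blinfun[of T "sgn v"] mult_left_mono[of "norm (sgn v)" 1 "norm T"]
  by (auto simp: norm_sgn split: if_splits)

lemma jet_apply_cons:
  "jet_apply (jet_cons T) vs = (case vs of [] \<Rightarrow> 0 | v # ws \<Rightarrow> jet_apply (T (sgn v)) ws)"
  unfolding jet_cons_def
  by (rule jet_apply_jet[where K = "norm T"])
    (auto split: list.split intro: order_trans[OF norm_jet_apply_le norm_blinfun_sgn_le])

lemma bounded_linear_jet_cons: "bounded_linear jet_cons"
proof (rule bounded_linear_intro[where K = 1])
  show "norm (jet_cons T) \<le> norm T * 1" for T
    by (rule norm_jet_le)
      (auto simp: jet_apply_cons split: list.split
        intro: order_trans[OF norm_jet_apply_le norm_blinfun_sgn_le])
qed (auto intro!: jet_eqI simp: jet_apply_cons jet_apply_add jet_apply_scaleR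
    blinfun.add_left blinfun.scaleR_left split: list.split)

lemma norm_jet_cons: "norm T \<le> norm (jet_cons T)"
proof (rule norm_blinfun_bound)
  fix v
  have "norm (T (sgn v)) \<le> norm (jet_cons T)"
    by (rule norm_jet_le) (use norm_jet_apply_le[of "jet_cons T" "v # _"] in \<open>simp add: jet_apply_cons\<close>)
  moreover have "T v = norm v *\<^sub>R T (sgn v)"
    by (cases "v = 0") (simp_all add: blinfun.scaleR_right[symmetric] sgn_div_norm)
  ultimately show "norm (T v) \<le> norm (jet_cons T) * norm v"
    by (simp add: mult.commute mult_left_mono)
qed simp

lemma Ck_on_jet_cons_iff:
  fixes f' :: "'d::real_normed_vector \<Rightarrow> 'e::real_normed_vector \<Rightarrow>\<^sub>L ('e, 'b::banach) jet"
  assumes "open S"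
  shows "Ck_on k (\<lambda>x. jet_cons (f' x)) S \<longleftrightarrow> Ck_on k f' S"
  by (rule Ck_on_embedding_iff[OF bounded_linear_jet_cons norm_jet_cons assms])

lemma Ck_on_jet_const_iff:
  fixes f :: "'d::real_normed_vector \<Rightarrow> 'b::banach"
  assumes "open S"
  shows "Ck_on k (\<lambda>x. jet_const (f x) :: ('e, 'b) jet) S \<longleftrightarrow> Ck_on k f S"
  by (rule Ck_on_embedding_iff[OF bounded_linear_jet_const norm_jet_const assms])

text \<open>Decodes \<open>jet_cons\<close> in the direction \<open>sgn v\<close>, but makes sense
  for every jet, whether or not it encodes an operator.\<close>

definition jet_shift :: "('e, 'b::metric_space) jet \<Rightarrow> 'e \<Rightarrow> ('e, 'b) jet" where
  "jet_shift \<phi> v = jet (\<lambda>ws. jet_apply \<phi> (v # ws))"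

lemma jet_apply_shift: "jet_apply (jet_shift \<phi> v) ws = jet_apply \<phi> (v # ws)"
  for \<phi> :: "('e, 'b::real_normed_vector) jet"
  unfolding jet_shift_def by (rule jet_apply_jet[OF norm_jet_apply_le])

lemma bounded_linear_jet_shift:
  fixes v :: 'e
  shows "bounded_linear (\<lambda>\<phi> :: ('e, 'b::real_normed_vector) jet. jet_shift \<phi> v)"
    and norm_jet_shift_le: "norm (jet_shift (\<phi> :: ('e, 'b) jet) v) \<le> norm \<phi>"
proof -
  show *: "norm (jet_shift (\<phi> :: ('e, 'b) jet) v) \<le> norm \<phi>" for \<phi>
    by (rule norm_jet_le) (simp add: jet_apply_shift norm_jet_apply_le)
  show "bounded_linear (\<lambda>\<phi> :: ('e, 'b) jet. jet_shift \<phi> v)"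
    by (rule bounded_linear_intro[where K = 1])
      (auto intro!: jet_eqI simp: * jet_apply_shift jet_apply_add jet_apply_scaleR)
qed

lemma jet_shift_cons: "jet_shift (jet_cons T) v = T (sgn v)"
  by (rule jet_eqI) (simp add: jet_apply_shift jet_apply_cons)

text \<open>One summand of the product rule, as an operator in the direction of
  differentiation.\<close>

definition blinfun_bilinear ::
  "('b \<Rightarrow> 'c \<Rightarrow> 'd) \<Rightarrow> ('e::real_normed_vector \<Rightarrow>\<^sub>L 'b::real_normed_vector) \<Rightarrow> 'c::real_normed_vector \<Rightarrow> 'e \<Rightarrow>\<^sub>L 'd::real_normed_vector" where
  "blinfun_bilinear mul T c = Blinfun (\<lambda>h. mul (T h) c)"

lemma blinfun_bilinear_apply:
  assumes "bounded_bilinear mul"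
  shows "blinfun_bilinear mul T c h = mul (T h) c"
proof -
  interpret bounded_bilinear mul by fact
  have "bounded_linear (\<lambda>h. mul (T h) c)"
    by (rule bounded_linear_compose[OF bounded_linear_left blinfun.bounded_linear_right])
  then show ?thesis unfolding blinfun_bilinear_def by (simp add: bounded_linear_Blinfun_apply)
qed

lemma bounded_bilinear_blinfun_bilinear:
  assumes "bounded_bilinear mul"
  shows "bounded_bilinear (blinfun_bilinear mul)"
proof -
  interpret bounded_bilinear mul by fact
  obtain K where K: "K \<ge> 0" "\<And>a b. norm (mul a b) \<le> norm a * norm b * K"
    using nonneg_bounded by blast
  show ?thesis
  proof
    show "\<exists>K. \<forall>T c. norm (blinfun_bilinear mul T c) \<le> norm T * norm c * K"
    proof (intro exI allI norm_blinfun_bound)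
      fix T c h
      show "norm (blinfun_bilinear mul T c h) \<le> norm T * norm c * K * norm h"
        using K(2)[of "T h" c] mult_right_mono[OF norm_blinfun[of T h], of "norm c * K"] K(1)
        by (simp add: blinfun_bilinear_apply[OF assms] algebra_simps)
    qed (use K in simp)
  qed (auto intro!: blinfun_eqI simp: blinfun_bilinear_apply[OF assms] blinfun.add_left
      blinfun.scaleR_left add_left add_right scaleR_left scaleR_right)
qed

text \<open>What \<open>blinfun_bilinear mul\<close> becomes under the encoding
  \<open>jet_cons\<close>, extended to all jets. It is again a bounded bilinear map between the same
  spaces as \<open>mul\<close>, which is what the induction in \<open>Ck_on_bilinear_jet\<close>
  lives on.\<close>

definition jet_bilinear ::
  "(('e, 'b) jet \<Rightarrow> 'c \<Rightarrow> ('e, 'd) jet) \<Rightarrow> ('e, 'b::metric_space) jet \<Rightarrow> 'c \<Rightarrow> ('e, 'd::real_normed_vector) jet" where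
  "jet_bilinear mul \<phi> c = jet (\<lambda>vs. case vs of [] \<Rightarrow> 0 | v # ws \<Rightarrow> jet_apply (mul (jet_shift \<phi> v) c) ws)"

lemma
  fixes mul :: "('e, 'b::real_normed_vector) jet \<Rightarrow> 'c::real_normed_vector \<Rightarrow> ('e, 'd::real_normed_vector) jet"
  assumes "bounded_bilinear mul"
  shows jet_apply_bilinear: "jet_apply (jet_bilinear mul \<phi> c) vs =
      (case vs of [] \<Rightarrow> 0 | v # ws \<Rightarrow> jet_apply (mul (jet_shift \<phi> v) c) ws)"
    and bounded_bilinear_jet_bilinear: "bounded_bilinear (jet_bilinear mul)"
proof -
  interpret bounded_bilinear mul by fact
  obtain K where K: "K \<ge> 0" "\<And>a b. norm (mul a b) \<le> norm a * norm b * K"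
    using nonneg_bounded by blast
  have bound: "norm (case vs of [] \<Rightarrow> 0 | v # ws \<Rightarrow> jet_apply (mul (jet_shift \<phi> v) c) ws) \<le> norm \<phi> * norm c * K"
    for vs \<phi> c
  proof (cases vs)
    case (Cons v ws)
    have "norm (jet_apply (mul (jet_shift \<phi> v) c) ws) \<le> norm (jet_shift \<phi> v) * norm c * K"
      by (rule order_trans[OF norm_jet_apply_le K(2)])
    also have "\<dots> \<le> norm \<phi> * norm c * K"
      using K(1) by (intro mult_right_mono norm_jet_shift_le) auto
    finally show ?thesis using Cons by simp
  qed (use K in simp)
  show *: "jet_apply (jet_bilinear mul \<phi> c) vs =
      (case vs of [] \<Rightarrow> 0 | v # ws \<Rightarrow> jet_apply (mul (jet_shift \<phi> v) c) ws)" for \<phi> c vs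
    unfolding jet_bilinear_def by (rule jet_apply_jet[OF bound])
  show "bounded_bilinear (jet_bilinear mul)"
  proof
    show "\<exists>K. \<forall>\<phi> c. norm (jet_bilinear mul \<phi> c) \<le> norm \<phi> * norm c * K"
      using bound by (intro exI[of _ K] allI norm_jet_le) (simp only: *)
  qed (auto intro!: jet_eqI simp: * jet_apply_add jet_apply_scaleR add_left add_right scaleR_left scaleR_right
      linear_add[OF bounded_linear.linear[OF bounded_linear_jet_shift(1)]] linear_scale[OF bounded_linear.linear[OF bounded_linear_jet_shift(1)]] split: list.split)
qed

lemma jet_bilinear_cons:
  assumes "bounded_bilinear mul"
  shows "jet_bilinear mul (jet_cons T) c = jet_cons (blinfun_bilinear mul T c)"
  by (rule jet_eqI)
    (simp add: jet_apply_bilinear[OF assms] jet_apply_cons jet_shift_cons blinfun_bilinear_apply[OF assms] split: list.split)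

text \<open>The encoded derivative of the product is a sum of two products,
  \<open>jet_bilinear\<close> applied to an encoded derivative and the other factor. All types are
  unchanged, so the induction hypothesis applies to them with another \<open>mul\<close>.\<close>

lemma Ck_on_bilinear_jet:
  fixes f :: "'e::real_normed_vector \<Rightarrow> ('e, 'b::banach) jet" and g :: "'e \<Rightarrow> ('e, 'c::banach) jet"
    and mul :: "('e::real_normed_vector, 'b::banach) jet \<Rightarrow> ('e, 'c::banach) jet \<Rightarrow> ('e, 'd::banach) jet"
  assumes "bounded_bilinear mul" "open S" "Ck_on k f S" "Ck_on k g S"
  shows "Ck_on k (\<lambda>x. mul (f x) (g x)) S"
  using assms
proof (induction k arbitrary: mul f g)
  case 0
  then show ?case by (simp add: Ck_on_0 bounded_bilinear.continuous_on)
next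
  case (Suc k)
  interpret bounded_bilinear mul by fact
  have flip: "bounded_bilinear (\<lambda>a b. mul b a)" by (rule flip)
  obtain f' where f': "\<And>x. x \<in> S \<Longrightarrow> (f has_derivative blinfun_apply (f' x)) (at x within S)" "Ck_on k f' S"
    using Suc.prems(3) unfolding Ck_on_Suc by blast
  obtain g' where g': "\<And>x. x \<in> S \<Longrightarrow> (g has_derivative blinfun_apply (g' x)) (at x within S)" "Ck_on k g' S"
    using Suc.prems(4) unfolding Ck_on_Suc by blast
  let ?D = "\<lambda>x. blinfun_bilinear (\<lambda>a b. mul b a) (g' x) (f x) + blinfun_bilinear mul (f' x) (g x)"
  have "Ck_on k (\<lambda>x. jet_cons (?D x)) S"
    unfolding linear_add[OF bounded_linear.linear[OF bounded_linear_jet_cons]] jet_bilinear_cons[symmetric, OF flip]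
      jet_bilinear_cons[symmetric, OF Suc.prems(1)]
    using Suc.prems(2,3,4) f'(2) g'(2)
    by (intro Ck_on_add Suc.IH[of "jet_bilinear mul"]
        Suc.IH[of "\<lambda>a b. jet_bilinear (\<lambda>a b. mul b a) b a"] bounded_bilinear_jet_bilinear[OF Suc.prems(1)]
        bounded_bilinear.flip[OF bounded_bilinear_jet_bilinear[OF flip]])
      (auto simp: Ck_on_jet_cons_iff intro: Ck_on_Suc_imp)
  then have "Ck_on k ?D S"
    using Ck_on_jet_cons_iff[OF Suc.prems(2)] by blast
  moreover have "((\<lambda>x. mul (f x) (g x)) has_derivative blinfun_apply (?D x)) (at x within S)" if "x \<in> S" for x
    by (rule has_derivative_eq_rhs[OF FDERIV[OF f'(1) g'(1), OF that that]])
      (simp add: fun_eq_iff blinfun.add_left blinfun_bilinear_apply[OF flip] blinfun_bilinear_apply[OF Suc.prems(1)])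
  ultimately show ?case
    unfolding Ck_on_Suc by (intro exI[of _ ?D] conjI ballI)
qed

lemma bounded_bilinear_linear_image:
  assumes "bounded_linear L" "bounded_bilinear mul"
  shows "bounded_bilinear (\<lambda>a b. L (mul a b))"
proof -
  interpret L: bounded_linear L by fact
  interpret bounded_bilinear mul by fact
  obtain K where K: "K \<ge> 0" "\<And>x. norm (L x) \<le> norm x * K"
    using L.nonneg_bounded by blast
  obtain M where M: "\<And>a b. norm (mul a b) \<le> norm a * norm b * M"
    using bounded by blast
  have "norm (L (mul a b)) \<le> norm a * norm b * (M * K)" for a b
    using order_trans[OF K(2) mult_right_mono[OF M K(1)]] by (simp add: mult.assoc)
  then show ?thesis
    by unfold_locales (auto simp: add_left add_right scaleR_left scaleR_right L.add L.scaleR)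
qed

lemma Ck_on_bilinear:
  fixes mul :: "'b::banach \<Rightarrow> 'c::banach \<Rightarrow> 'd::banach" and f :: "'e::real_normed_vector \<Rightarrow> 'b"
  assumes "bounded_bilinear mul" "open S" "Ck_on k f S" "Ck_on k g S"
  shows "Ck_on k (\<lambda>x. mul (f x) (g x)) S"
proof -
  \<comment> \<open>The choice of \<open>[]\<close> is immaterial, as only constant jets are
    inserted.\<close>
  let ?p = "\<lambda>(\<phi> :: ('e, 'b) jet) (\<psi> :: ('e, 'c) jet). jet_const (mul (jet_apply \<phi> []) (jet_apply \<psi> [])) :: ('e, 'd) jet"
  have "bounded_bilinear ?p"
    by (rule bounded_bilinear_linear_image[OF bounded_linear_jet_const
          bounded_bilinear.comp[OF assms(1) bounded_linear_jet_apply bounded_linear_jet_apply]])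
  moreover have "Ck_on k (\<lambda>x. jet_const (f x) :: ('e, 'b) jet) S" "Ck_on k (\<lambda>x. jet_const (g x) :: ('e, 'c) jet) S"
    using assms by (simp_all only: Ck_on_jet_const_iff)
  ultimately have "Ck_on k (\<lambda>x. ?p (jet_const (f x)) (jet_const (g x))) S"
    by (rule Ck_on_bilinear_jet[of ?p, OF _ assms(2)])
  then show ?thesis
    by (simp only: jet_apply_const Ck_on_jet_const_iff[OF assms(2)])
qed

text \<open>In the derivative \<open>f' (G x) o\<^sub>L G' x\<close> the first factor is again an
  outer map composed with \<open>G\<close>. Encoded by \<open>jet_cons\<close> it has the type of
  \<open>f\<close>, so the induction hypothesis covers it; the product rule does the rest.\<close>

lemma Ck_on_compose_jet:
  fixes f :: "'e::banach \<Rightarrow> ('e, 'b::banach) jet" and G :: "'d::real_normed_vector \<Rightarrow> 'e"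
  assumes "open S" "open T" "G ` S \<subseteq> T" "Ck_on k f T" "Ck_on k G S"
  shows "Ck_on k (\<lambda>x. f (G x)) S"
  using assms(4,5)
proof (induction k arbitrary: f)
  case 0
  then show ?case using assms(3) by (auto simp: Ck_on_0 intro: continuous_on_compose2)
next
  case (Suc k)
  obtain f' where f': "\<And>x. x \<in> T \<Longrightarrow> (f has_derivative blinfun_apply (f' x)) (at x within T)" "Ck_on k f' T"
    using Suc.prems(1) unfolding Ck_on_Suc by blast
  obtain G' where G': "\<And>x. x \<in> S \<Longrightarrow> (G has_derivative blinfun_apply (G' x)) (at x within S)" "Ck_on k G' S"
    using Suc.prems(2) unfolding Ck_on_Suc by blast
  have "Ck_on k (\<lambda>x. jet_cons (f' (G x))) S"
    using f'(2) Suc.prems(2) by (intro Suc.IH) (auto simp: Ck_on_jet_cons_iff assms intro: Ck_on_Suc_imp)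
  then have "Ck_on k (\<lambda>x. f' (G x)) S"
    using Ck_on_jet_cons_iff[OF assms(1)] by blast
  then have "Ck_on k (\<lambda>x. f' (G x) o\<^sub>L G' x) S"
    by (rule Ck_on_bilinear[OF bounded_bilinear_blinfun_compose assms(1) _ G'(2)])
  moreover have "((\<lambda>x. f (G x)) has_derivative blinfun_apply (f' (G x) o\<^sub>L G' x)) (at x within S)" if "x \<in> S" for x
  proof -
    have "(f has_derivative blinfun_apply (f' (G x))) (at (G x) within G ` S)"
      using f'(1)[of "G x"] assms(3) that by (auto intro: has_derivative_subset)
    from has_derivative_eq_rhs[OF diff_chain_within[OF G'(1)[OF that] this]] show ?thesis
      by (simp add: o_def fun_eq_iff)
  qed
  ultimately show ?case
    unfolding Ck_on_Suc by (intro exI[of _ "\<lambda>x. f' (G x) o\<^sub>L G' x"] conjI ballI)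
qed

lemma Ck_on_compose:
  fixes f :: "'e::banach \<Rightarrow> 'b::banach" and G :: "'d::real_normed_vector \<Rightarrow> 'e"
  assumes "open S" "open T" "G ` S \<subseteq> T" "Ck_on k f T" "Ck_on k G S"
  shows "Ck_on k (\<lambda>x. f (G x)) S"
  using Ck_on_compose_jet[OF assms(1-3), of k "\<lambda>x. jet_const (f x)"] assms
  by (simp add: Ck_on_jet_const_iff)

section \<open>Inverse operators and implicit functions\<close>

lemma Ck_on_SucI:
  fixes f' :: "'a::real_normed_vector \<Rightarrow> 'a \<Rightarrow>\<^sub>L 'b::real_normed_vector"
  assumes "\<And>x. x \<in> S \<Longrightarrow> (f has_derivative blinfun_apply (f' x)) (at x within S)" "Ck_on k f' S"
  shows "Ck_on (Suc k) f S"
  unfolding Ck_on_Suc using assms by (intro exI[of _ f'] conjI ballI)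

text \<open>The resolvent identity, which turns increments of \<open>A\<close> into increments of
  its inverse.\<close>

lemma blinfun_inverse_diff:
  assumes "P' o\<^sub>L A' = id_blinfun" "A o\<^sub>L P = id_blinfun"
  shows "P' - P = - (P' o\<^sub>L ((A' - A) o\<^sub>L P))"
proof (rule blinfun_eqI)
  fix y
  have "P' (A' x) = x" "A (P z) = z" for x z
    using assms by (metis blinfun_apply_blinfun_compose blinfun_apply_id_blinfun)+
  then show "(P' - P) y = (- (P' o\<^sub>L ((A' - A) o\<^sub>L P))) y"
    by (simp add: blinfun.diff_left blinfun.minus_left blinfun.diff_right)
qed

text \<open>Because \<open>g\<close> vanishes at \<open>x\<close>, the increment of \<open>f\<close>
  meets a factor of order \<open>norm (y - x)\<close>, so continuity of \<open>f\<close> is enough.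
  In the resolvent identity the factor \<open>P y\<close> is known to be continuous before it is
  known to be differentiable.\<close>

lemma has_derivative_bilinear_vanishing:
  assumes "bounded_bilinear mul" "continuous (at x within S) f"
    "(g has_derivative g') (at x within S)" "g x = 0"
  shows "((\<lambda>y. mul (f y) (g y)) has_derivative (\<lambda>h. mul (f x) (g' h))) (at x within S)"
proof -
  interpret bounded_bilinear mul by fact
  interpret g': bounded_linear g' using assms(3) by (rule has_derivative_bounded_linear)
  obtain K where K: "K > 0" "\<And>a b. norm (mul a b) \<le> norm a * norm b * K"
    using pos_bounded by blast
  obtain M where M: "M > 0" "\<And>h. norm (g' h) \<le> norm h * M"
    using g'.pos_bounded by blast
  let ?e = "\<lambda>y. norm (g y - g x - g' (y - x)) / norm (y - x)"
  let ?h = "\<lambda>y. norm (f y) * ?e y * K + norm (f y - f x) * M * K"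
  have "(?e \<longlongrightarrow> 0) (at x within S)" "(f \<longlongrightarrow> f x) (at x within S)"
    using assms(2,3) by (auto simp: has_derivative_iff_norm continuous_within)
  then have "(?h \<longlongrightarrow> norm (f x) * 0 * K + norm (f x - f x) * M * K) (at x within S)"
    by (intro tendsto_intros)
  then have lim: "(?h \<longlongrightarrow> 0) (at x within S)" by simp
  have le: "norm (norm (mul (f y) (g y) - mul (f x) (g x) - mul (f x) (g' (y - x))) / norm (y - x)) \<le> ?h y"
    if "y \<noteq> x" for y
  proof -
    have "mul (f y) (g y) - mul (f x) (g x) - mul (f x) (g' (y - x))
        = mul (f y) (g y - g x - g' (y - x)) + mul (f y - f x) (g' (y - x))"
      using assms(4) by (simp add: diff_right diff_left zero_right)
    also have "norm \<dots> \<le> norm (f y) * norm (g y - g x - g' (y - x)) * K + norm (f y - f x) * norm (g' (y - x)) * K"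
      by (rule norm_triangle_le[OF add_mono[OF K(2) K(2)]])
    also have "\<dots> \<le> norm (f y) * norm (g y - g x - g' (y - x)) * K + norm (f y - f x) * (norm (y - x) * M) * K"
      using K(1) by (intro add_left_mono mult_right_mono mult_left_mono M) auto
    finally show ?thesis using that by (simp add: field_simps)
  qed
  have "bounded_linear (\<lambda>h. mul (f x) (g' h))"
    by (rule bounded_linear_compose[OF bounded_linear_right g'.bounded_linear_axioms])
  then show ?thesis
    unfolding has_derivative_iff_norm
    by (intro conjI null_comparison_within[OF lim le])
qed

text \<open>The uniform bound and the resolvent identity give continuity of \<open>P\<close>. Its
  derivative is a product of \<open>P\<close>, \<open>A'\<close> and \<open>P\<close>, so each order
  of regularity of \<open>P\<close> yields the next, as far as \<open>A\<close> allows.\<close>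

lemma Ck_on_blinfun_inverse:
  fixes A :: "'d::real_normed_vector \<Rightarrow> 'a::banach \<Rightarrow>\<^sub>L 'b::banach"
  assumes "open S" "Ck_on k A S"
    and inv: "\<And>x. x \<in> S \<Longrightarrow> P x o\<^sub>L A x = id_blinfun" "\<And>x. x \<in> S \<Longrightarrow> A x o\<^sub>L P x = id_blinfun"
    and bound: "\<And>x. x \<in> S \<Longrightarrow> norm (P x) \<le> C"
  shows "Ck_on k P S"
proof -
  have "continuous_on S A"
    using Ck_on_mono[OF assms(2), of 0] by (simp add: Ck_on_0)
  have cont: "continuous_on S P"
    unfolding continuous_on_def
  proof
    fix x assume x: "x \<in> S"
    have "((\<lambda>y. norm (A y - A x)) \<longlongrightarrow> 0) (at x within S)"
      using \<open>continuous_on S A\<close> x by (auto simp: continuous_on_def tendsto_norm_zero_iff LIM_zero_iff)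
    from tendsto_mult_right_zero[OF this, of "C * C"]
    have lim: "((\<lambda>y. C * C * norm (A y - A x)) \<longlongrightarrow> 0) (at x within S)" .
    have "norm (P y - P x) \<le> C * C * norm (A y - A x)" if y: "y \<in> S" for y
    proof -
      have "0 \<le> C" using bound[OF x] norm_ge_zero order_trans by blast
      have "norm (P y - P x) = norm (P y o\<^sub>L ((A y - A x) o\<^sub>L P x))"
        using blinfun_inverse_diff[OF inv(1)[OF y] inv(2)[OF x]] by simp
      also have "\<dots> \<le> norm (P y) * (norm (A y - A x) * norm (P x))"
        by (rule order_trans[OF norm_blinfun_compose mult_left_mono[OF norm_blinfun_compose]]) simp
      also have "\<dots> \<le> C * (norm (A y - A x) * C)"
        using \<open>0 \<le> C\<close> bound x y by (intro mult_mono) auto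
      finally show ?thesis by (simp add: algebra_simps)
    qed
    then have "((\<lambda>y. P y - P x) \<longlongrightarrow> 0) (at x within S)"
      by (rule null_comparison_within[OF lim])
    then show "(P \<longlongrightarrow> P x) (at x within S)" by (simp add: LIM_zero_iff)
  qed
  note flip = bounded_bilinear.flip[OF bounded_bilinear_blinfun_compose]
  show ?thesis
    using assms(2)
  proof (induction k)
    case 0
    then show ?case using cont by (simp add: Ck_on_0)
  next
    case (Suc k)
    obtain A' where A': "\<And>x. x \<in> S \<Longrightarrow> (A has_derivative blinfun_apply (A' x)) (at x within S)" "Ck_on k A' S"
      using Suc.prems unfolding Ck_on_Suc by blast
    have P: "Ck_on k P S"
      by (rule Suc.IH[OF Ck_on_Suc_imp[OF Suc.prems]])
    \<comment> \<open>As an operator in \<open>h\<close>, this is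
      \<open>P x o\<^sub>L (A' x h o\<^sub>L P x)\<close>.\<close>
    define Q where "Q x = blinfun_bilinear (\<lambda>R T. T o\<^sub>L R) (blinfun_bilinear (o\<^sub>L) (A' x) (P x)) (P x)" for x
    have "Ck_on k (\<lambda>x. - Q x) S"
      unfolding Q_def
      by (rule Ck_on_bounded_linear[OF bounded_linear_minus[OF bounded_linear_ident] assms(1)],
        rule Ck_on_bilinear[OF bounded_bilinear_blinfun_bilinear[OF flip] assms(1) _ P],
        rule Ck_on_bilinear[OF bounded_bilinear_blinfun_bilinear[OF bounded_bilinear_blinfun_compose] assms(1) A'(2) P])
    moreover have "(P has_derivative blinfun_apply (- Q x)) (at x within S)" if x: "x \<in> S" for x
    proof -
      have "((\<lambda>y. (A y - A x) o\<^sub>L P x) has_derivative (\<lambda>h. A' x h o\<^sub>L P x)) (at x within S)"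
        using bounded_linear.has_derivative[OF bounded_bilinear.bounded_linear_left[OF bounded_bilinear_blinfun_compose]
            has_derivative_diff[OF A'(1)[OF x] has_derivative_const[of "A x"]]] by simp
      from has_derivative_bilinear_vanishing[OF bounded_bilinear_blinfun_compose _ this, of P] cont x
      have "((\<lambda>y. P y o\<^sub>L ((A y - A x) o\<^sub>L P x)) has_derivative (\<lambda>h. P x o\<^sub>L (A' x h o\<^sub>L P x))) (at x within S)"
        by (simp add: continuous_on_eq_continuous_within)
      from has_derivative_diff[OF has_derivative_const[of "P x"] this]
      have der: "((\<lambda>y. P x - (P y o\<^sub>L ((A y - A x) o\<^sub>L P x))) has_derivative blinfun_apply (- Q x)) (at x within S)"
        by (rule has_derivative_eq_rhs)
          (simp add: fun_eq_iff Q_def blinfun.minus_left blinfun_bilinear_apply[OF flip]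
            blinfun_bilinear_apply[OF bounded_bilinear_blinfun_compose])
      have "P y = P x - (P y o\<^sub>L ((A y - A x) o\<^sub>L P x))" if y: "y \<in> S" for y
        using blinfun_inverse_diff[OF inv(1)[OF y] inv(2)[OF x]] by (simp add: algebra_simps)
      from has_derivative_transform[OF x this der] show ?thesis .
    qed
    ultimately show ?case by (intro Ck_on_SucI[where f' = "\<lambda>x. - Q x"])
  qed
qed

definition blinfun_inl :: "'a::real_normed_vector \<Rightarrow>\<^sub>L ('a \<times> 'b::real_normed_vector)" where
  "blinfun_inl = Blinfun (\<lambda>x. (x, 0))"

definition blinfun_inr :: "'b::real_normed_vector \<Rightarrow>\<^sub>L ('a::real_normed_vector \<times> 'b)" where
  "blinfun_inr = Blinfun (\<lambda>x. (0, x))"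

lemma blinfun_inl_apply [simp]: "blinfun_inl x = (x, 0)"
  unfolding blinfun_inl_def
  by (simp add: bounded_linear_Blinfun_apply bounded_linear_Pair)

lemma blinfun_inr_apply [simp]: "blinfun_inr x = (0, x)"
  unfolding blinfun_inr_def
  by (simp add: bounded_linear_Blinfun_apply bounded_linear_Pair)

text \<open>Along the graph of \<open>u\<close> the increment of \<open>F\<close> is 0, so
  \<open>F'\<close> applied to the increment of \<open>(u \<mu>, \<mu>)\<close> is small relative to
  it. Applying \<open>P\<close> gives the claimed remainder, measured however by the increments of
  both \<open>u\<close> and \<open>\<mu>\<close>; the former is absorbed.\<close>

lemma implicit_has_derivative:
  fixes F :: "'a::real_normed_vector \<times> 'm::real_normed_vector \<Rightarrow> 'b::real_normed_vector"
  assumes "(F has_derivative blinfun_apply F') (at (u \<mu>, \<mu>))"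
    and P: "P o\<^sub>L (F' o\<^sub>L blinfun_inl) = id_blinfun"
    and "open S" "\<mu> \<in> S" "continuous_on S u" and F0: "\<And>\<mu>. \<mu> \<in> S \<Longrightarrow> F (u \<mu>, \<mu>) = 0"
  shows "(u has_derivative blinfun_apply (- (P o\<^sub>L (F' o\<^sub>L blinfun_inr)))) (at \<mu>)"
proof -
  let ?B = "P o\<^sub>L (F' o\<^sub>L blinfun_inr)"
  \<comment> \<open>Solving \<open>a <= (a + b) / 2 + norm ?B * b\<close> for \<open>a + b\<close>
    gives \<open>a + b <= N * b\<close>; here \<open>a\<close> and \<open>b\<close> are the norms of
    the increments of \<open>u\<close> and of \<open>\<mu>\<close>. The 1 in \<open>C\<close> keeps
    it positive even if \<open>P\<close> is 0.\<close>
  define N where "N = 2 * norm ?B + 2"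
  define C where "C = norm P + 1"
  have N: "N > 0" and C: "C > 0" by (auto simp: N_def C_def add_nonneg_pos)
  have key: "\<exists>d>0. \<forall>\<nu>. norm (\<nu> - \<mu>) < d \<longrightarrow> norm (u \<nu> - u \<mu> + ?B (\<nu> - \<mu>)) \<le> e * norm (\<nu> - \<mu>)"
    if e: "e > 0" for e
  proof -
    \<comment> \<open>The first bound allows the absorption with factor \<open>1 / 2\<close>, the
      second makes the final constant \<open>C * \<eta> * N\<close> at most
      \<open>e\<close>.\<close>
    define \<eta> where "\<eta> = min (1 / (2 * C)) (e / (C * N))"
    have \<eta>: "\<eta> > 0" "C * \<eta> \<le> 1 / 2" "C * \<eta> * N \<le> e"
    proof -
      show "\<eta> > 0" using e N C by (simp add: \<eta>_def)
      have "C * \<eta> \<le> C * (1 / (2 * C))" "C * \<eta> \<le> C * (e / (C * N))"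
        using C by (intro mult_left_mono; simp add: \<eta>_def)+
      then have "C * \<eta> \<le> 1 / 2" "C * \<eta> \<le> e / N" using C by auto
      then show "C * \<eta> \<le> 1 / 2" "C * \<eta> * N \<le> e" using N by (auto simp: field_simps)
    qed
    obtain d1 where d1: "d1 > 0" "\<And>p. norm (p - (u \<mu>, \<mu>)) < d1 \<Longrightarrow>
        norm (F p - F (u \<mu>, \<mu>) - F' (p - (u \<mu>, \<mu>))) \<le> \<eta> * norm (p - (u \<mu>, \<mu>))"
      using assms(1) \<eta>(1) unfolding has_derivative_at_alt by blast
    have "isCont u \<mu>"
      using assms(3-5) continuous_on_eq_continuous_at by blast
    then have "isCont (\<lambda>\<nu>. (u \<nu>, \<nu>)) \<mu>"
      by (intro continuous_Pair continuous_ident)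
    then obtain d2 where d2: "d2 > 0" "\<And>\<nu>. norm (\<nu> - \<mu>) < d2 \<Longrightarrow> norm ((u \<nu>, \<nu>) - (u \<mu>, \<mu>)) < d1"
      using d1(1) unfolding continuous_at_eps_delta dist_norm by blast
    obtain d3 where d3: "d3 > 0" "\<And>\<nu>. norm (\<nu> - \<mu>) < d3 \<Longrightarrow> \<nu> \<in> S"
      using assms(3,4) unfolding open_dist dist_norm by blast
    have "norm (u \<nu> - u \<mu> + ?B (\<nu> - \<mu>)) \<le> e * norm (\<nu> - \<mu>)" if \<nu>: "norm (\<nu> - \<mu>) < min d2 d3" for \<nu>
    proof -
      let ?du = "u \<nu> - u \<mu>" and ?dm = "\<nu> - \<mu>"
      have split: "(?du, ?dm) = blinfun_inl ?du + blinfun_inr ?dm" by simp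
      have "P (F' (blinfun_inl x)) = x" for x
        using P by (metis blinfun_apply_blinfun_compose blinfun_apply_id_blinfun)
      then have "P (F' (?du, ?dm)) = ?du + ?B ?dm"
        unfolding split by (simp only: blinfun.add_right blinfun_apply_blinfun_compose)
      then have "norm (?du + ?B ?dm) \<le> norm P * norm (F' (?du, ?dm))"
        using norm_blinfun[of P "F' (?du, ?dm)"] by simp
      also have "\<dots> \<le> C * norm (F' (?du, ?dm))"
        by (intro mult_right_mono) (auto simp: C_def)
      also have "norm (F' (?du, ?dm)) \<le> \<eta> * norm (?du, ?dm)"
        using d1(2)[OF d2(2)[of \<nu>]] \<nu> F0[OF assms(4)] F0[OF d3(2)[of \<nu>]] by simp
      also have "norm (?du, ?dm) \<le> norm ?du + norm ?dm"
        by (rule norm_Pair_le)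
      finally have 1: "norm (?du + ?B ?dm) \<le> C * \<eta> * (norm ?du + norm ?dm)"
        using C \<eta>(1) by (simp add: mult.assoc)
      have "norm ?du \<le> norm (?du + ?B ?dm) + norm (?B ?dm)"
        using norm_triangle_ineq4[of "?du + ?B ?dm" "?B ?dm"] by simp
      also have "\<dots> \<le> 1 / 2 * (norm ?du + norm ?dm) + norm ?B * norm ?dm"
        using order_trans[OF 1 mult_right_mono[OF \<eta>(2)]]
        by (intro add_mono norm_blinfun) auto
      finally have "norm ?du + norm ?dm \<le> N * norm ?dm"
        by (simp add: N_def algebra_simps)
      with 1 have "norm (?du + ?B ?dm) \<le> C * \<eta> * (N * norm ?dm)"
        using C \<eta>(1) by (meson mult_left_mono mult_nonneg_nonneg less_imp_le order_trans)
      also have "\<dots> \<le> e * norm ?dm"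
        using mult_right_mono[OF \<eta>(3), of "norm ?dm"] by (simp add: mult.assoc)
      finally show ?thesis .
    qed
    then show ?thesis using d2(1) d3(1) by (intro exI[of _ "min d2 d3"]) auto
  qed
  show ?thesis
    unfolding has_derivative_at_alt
    using key by (auto simp: blinfun.bounded_linear_right blinfun.minus_left)
qed

text \<open>Bootstrapping: if \<open>u\<close> is \<open>C^j\<close>, then so are the derivative of
  \<open>F\<close> along its graph and the inverse of the partial derivative, hence the derivative
  of \<open>u\<close> is \<open>C^j\<close>. This can be repeated while
  \<open>j <= k\<close>.\<close>

lemma Ck_on_implicit:
  fixes F :: "'a::banach \<times> 'm::banach \<Rightarrow> 'b::banach"
  assumes "open S" "open T" "continuous_on S u"
    and uT: "\<And>\<mu>. \<mu> \<in> S \<Longrightarrow> (u \<mu>, \<mu>) \<in> T" and F0: "\<And>\<mu>. \<mu> \<in> S \<Longrightarrow> F (u \<mu>, \<mu>) = 0"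
    and F': "\<And>p. p \<in> T \<Longrightarrow> (F has_derivative blinfun_apply (F' p)) (at p)" "Ck_on k F' T"
    and P: "\<And>\<mu>. \<mu> \<in> S \<Longrightarrow> P \<mu> o\<^sub>L (F' (u \<mu>, \<mu>) o\<^sub>L blinfun_inl) = id_blinfun"
      "\<And>\<mu>. \<mu> \<in> S \<Longrightarrow> (F' (u \<mu>, \<mu>) o\<^sub>L blinfun_inl) o\<^sub>L P \<mu> = id_blinfun"
      "\<And>\<mu>. \<mu> \<in> S \<Longrightarrow> norm (P \<mu>) \<le> C"
  shows "Ck_on (Suc k) u S"
proof -
  have step: "Ck_on (Suc j) u S" if "Ck_on j u S" "j \<le> k" for j
  proof -
    have "Ck_on j (\<lambda>\<mu>. (u \<mu>, \<mu>)) S"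
      by (rule Ck_on_Pair[OF that(1) Ck_on_id assms(1)])
    from Ck_on_compose[OF assms(1,2) _ Ck_on_mono[OF F'(2) that(2)] this] uT
    have G: "Ck_on j (\<lambda>\<mu>. F' (u \<mu>, \<mu>)) S" by auto
    note comp = bounded_bilinear.bounded_linear_left[OF bounded_bilinear_blinfun_compose]
    have "Ck_on j P S"
      by (rule Ck_on_blinfun_inverse[OF assms(1) Ck_on_bounded_linear[OF comp assms(1) G] P])
    from Ck_on_bilinear[OF bounded_bilinear_blinfun_compose assms(1) this Ck_on_bounded_linear[OF comp assms(1) G]]
    have "Ck_on j (\<lambda>\<mu>. - (P \<mu> o\<^sub>L (F' (u \<mu>, \<mu>) o\<^sub>L blinfun_inr))) S"
      by (rule Ck_on_bounded_linear[OF bounded_linear_minus[OF bounded_linear_ident] assms(1)])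
    then show ?thesis
      by (rule Ck_on_SucI[rotated])
        (rule has_derivative_at_withinI[OF implicit_has_derivative[OF F'(1)[OF uT] P(1) assms(1) _ assms(3) F0]])
  qed
  have "Ck_on j u S" if "j \<le> Suc k" for j
    using that by (induction j) (auto simp: Ck_on_0 assms(3) intro: step)
  then show ?thesis by simp
qed

section \<open>Strongly convex functions\<close>

text \<open>The value at a midpoint cannot fall below the infimum, so the midpoint inequality bounds
  \<open>c * (norm (v - w))\<^sup>2\<close> by the mean excess of \<open>f v\<close> and
  \<open>f w\<close> over the infimum. Almost minimal points are therefore close to each other, and
  completeness supplies the limit.\<close>

lemma strongly_convex_attains_min:
  fixes f :: "'a::banach \<Rightarrow> real"
  assumes "closed S" "S \<noteq> {}" "continuous_on S f" and lower: "\<And>x. x \<in> S \<Longrightarrow> m \<le> f x" and "c > 0"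
    and mid: "\<And>v w. v \<in> S \<Longrightarrow> w \<in> S \<Longrightarrow> midpoint v w \<in> S"
      "\<And>v w. v \<in> S \<Longrightarrow> w \<in> S \<Longrightarrow> f (midpoint v w) \<le> (f v + f w) / 2 - c * (norm (v - w))\<^sup>2"
  obtains z where "z \<in> S" "\<And>w. w \<in> S \<Longrightarrow> f z \<le> f w"
proof -
  define I where "I = Inf (f ` S)"
  have bdd: "bdd_below (f ` S)" using lower by (rule bdd_belowI2)
  have I_le: "I \<le> f x" if "x \<in> S" for x
    unfolding I_def using that bdd by (intro cINF_lower)
  have "\<exists>x\<in>S. f x < I + 1 / real (Suc n)" for n
    using cINF_less_iff[OF assms(2) bdd, of "I + 1 / real (Suc n)"] by (simp add: I_def)
  then obtain x where x: "\<And>n. x n \<in> S" "\<And>n. f (x n) < I + 1 / real (Suc n)"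
    by metis
  have close: "c * (norm (x i - x j))\<^sup>2 < 1 / real (Suc n)" if "i \<ge> n" "j \<ge> n" for i j n
  proof -
    have "1 / real (Suc i) \<le> 1 / real (Suc n)" "1 / real (Suc j) \<le> 1 / real (Suc n)"
      using that by (auto simp: frac_le)
    then show ?thesis
      using I_le[OF mid(1)[OF x(1)[of i] x(1)[of j]]] mid(2)[OF x(1)[of i] x(1)[of j]] x(2)[of i] x(2)[of j]
      by argo
  qed
  have "Cauchy x"
    unfolding Cauchy_def dist_norm
  proof (intro allI impI)
    fix e :: real assume "e > 0"
    then obtain n where n: "1 / real (Suc n) < c * e\<^sup>2"
      using nat_approx_posE[of "c * e\<^sup>2"] \<open>c > 0\<close> by auto
    have "norm (x i - x j) < e" if "i \<ge> n" "j \<ge> n" for i j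
    proof -
      have "c * (norm (x i - x j))\<^sup>2 < c * e\<^sup>2" using close[OF that] n by linarith
      then show ?thesis using \<open>c > 0\<close> \<open>e > 0\<close> by (auto intro: power_less_imp_less_base)
    qed
    then show "\<exists>M. \<forall>m\<ge>M. \<forall>n\<ge>M. norm (x m - x n) < e" by blast
  qed
  then obtain z where z: "x \<longlonglongrightarrow> z" using Cauchy_convergent_iff convergent_def by blast
  have zS: "z \<in> S"
    using closed_sequentially[OF assms(1) x(1) z] .
  have "(\<lambda>n. f (x n)) \<longlonglongrightarrow> f z"
    using continuous_on_tendsto_compose[OF assms(3) z zS] x(1) by simp
  moreover have "(\<lambda>n. I + 1 / real (Suc n)) \<longlonglongrightarrow> I + 0"
    by (intro tendsto_add tendsto_const LIMSEQ_Suc[OF lim_1_over_n])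
  ultimately have "f z \<le> I + 0"
    by (rule LIMSEQ_le) (use x(2) less_imp_le in blast)
  then show ?thesis using that[OF zS] I_le by force
qed

lemma has_derivative_along_line:
  assumes "(f has_derivative f') (at (v + t *\<^sub>R d))"
  shows "((\<lambda>t. f (v + t *\<^sub>R d)) has_vector_derivative f' d) (at t)"
proof -
  have "((\<lambda>t. v + t *\<^sub>R d) has_derivative (\<lambda>s. s *\<^sub>R d)) (at t)"
    by (auto intro!: derivative_eq_intros)
  from has_derivative_compose[OF this assms] show ?thesis
    using linear_scale[OF has_derivative_linear[OF assms]] by (simp add: has_vector_derivative_def)
qed

lemma convex_segment_point:
  assumes "convex S" "v \<in> S" "w \<in> S" "0 \<le> t" "t \<le> (1::real)"
  shows "v + t *\<^sub>R (w - v) \<in> S"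
  using convexD_alt[OF assms(1,2,3,4,5)] by (simp add: algebra_simps)

text \<open>With \<open>d = w - v\<close>, the function
  \<open>g (v + t *\<^sub>R d) d - t * (\<alpha> * (norm d)\<^sup>2)\<close> of \<open>t\<close> has
  a nonnegative derivative; its values at 0 and 1 are compared.\<close>

lemma coercive_imp_strongly_monotone:
  fixes g :: "'a::real_normed_vector \<Rightarrow> 'a \<Rightarrow>\<^sub>L real"
  assumes "convex S" "v \<in> S" "w \<in> S"
    and der: "\<And>x. x \<in> S \<Longrightarrow> (g has_derivative blinfun_apply (A x)) (at x)"
    and coercive: "\<And>x h. x \<in> S \<Longrightarrow> \<alpha> * (norm h)\<^sup>2 \<le> A x h h"
  shows "\<alpha> * (norm (w - v))\<^sup>2 \<le> (g w - g v) (w - v)"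
proof -
  define d where "d = w - v"
  have "((\<lambda>t. g (v + t *\<^sub>R d) d - t * (\<alpha> * (norm d)\<^sup>2)) has_real_derivative
      A (v + t *\<^sub>R d) d d - \<alpha> * (norm d)\<^sup>2) (at t)" if t: "0 \<le> t" "t \<le> 1" for t
  proof -
    have "((\<lambda>t. g (v + t *\<^sub>R d)) has_vector_derivative A (v + t *\<^sub>R d) d) (at t)"
      using has_derivative_along_line[OF der] convex_segment_point[OF assms(1-3) t] by (simp add: d_def)
    from bounded_linear.has_vector_derivative[OF bounded_bilinear.bounded_linear_left[OF bounded_bilinear_blinfun_apply] this, of d]
    have "((\<lambda>t. g (v + t *\<^sub>R d) d) has_real_derivative A (v + t *\<^sub>R d) d d) (at t)"
      by (simp add: has_real_derivative_iff_has_vector_derivative)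
    then show ?thesis by (auto intro!: derivative_eq_intros)
  qed
  then have "g (v + 0 *\<^sub>R d) d - 0 * (\<alpha> * (norm d)\<^sup>2) \<le> g (v + 1 *\<^sub>R d) d - 1 * (\<alpha> * (norm d)\<^sup>2)"
    using convex_segment_point[OF assms(1-3)] coercive
    by (intro DERIV_nonneg_imp_nondecreasing[of 0 1 "\<lambda>t. g (v + t *\<^sub>R d) d - t * (\<alpha> * (norm d)\<^sup>2)"])
      (force simp: d_def)+
  then show ?thesis by (simp add: d_def blinfun.diff_left)
qed

text \<open>Convexity is expressed by the gradient, since this condition survives subtraction of a
  bounded linear functional with the same \<open>\<alpha>\<close>.\<close>

locale strongly_monotone_gradient =
  fixes f :: "'a::banach \<Rightarrow> real" and f' :: "'a \<Rightarrow> 'a \<Rightarrow>\<^sub>L real" and S :: "'a set" and \<alpha> :: real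
  assumes deriv: "\<And>w. w \<in> S \<Longrightarrow> (f has_derivative blinfun_apply (f' w)) (at w)"
    and monotone: "\<And>v w. v \<in> S \<Longrightarrow> w \<in> S \<Longrightarrow> \<alpha> * (norm (w - v))\<^sup>2 \<le> (f' w - f' v) (w - v)"
    and convex: "convex S" and pos: "\<alpha> > 0"
begin

text \<open>Monotonicity between \<open>v\<close> and \<open>v + t *\<^sub>R d\<close> carries a
  factor \<open>t\<close>; once it is divided out, the inequality says that \<open>g\<close> has a
  nonnegative derivative. At \<open>t = 0\<close> both sides are 0.\<close>

lemma above_tangent:
  assumes "v \<in> S" "w \<in> S"
  shows "f v + f' v (w - v) + \<alpha> / 2 * (norm (w - v))\<^sup>2 \<le> f w"
proof -
  define d where "d = w - v"
  define g where "g t = f (v + t *\<^sub>R d) - t * f' v d - t\<^sup>2 * (\<alpha> / 2 * (norm d)\<^sup>2)" for t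
  have "\<exists>y. (g has_real_derivative y) (at t) \<and> 0 \<le> y" if t: "0 \<le> t" "t \<le> 1" for t
  proof -
    let ?x = "v + t *\<^sub>R d"
    have x: "?x \<in> S" using convex_segment_point[OF convex assms t] by (simp add: d_def)
    have "((\<lambda>t. f (v + t *\<^sub>R d)) has_real_derivative f' ?x d) (at t)"
      using has_derivative_along_line[OF deriv[OF x]]
      by (simp add: has_real_derivative_iff_has_vector_derivative)
    then have "(g has_real_derivative f' ?x d - f' v d - t * (\<alpha> * (norm d)\<^sup>2)) (at t)"
      unfolding g_def by (auto intro!: derivative_eq_intros)
    moreover have "t * (\<alpha> * (norm d)\<^sup>2) \<le> f' ?x d - f' v d"
    proof (cases "t = 0")
      case False
      then have "t > 0" using t by simp
      have "t * (t * (\<alpha> * (norm d)\<^sup>2)) \<le> t * (f' ?x d - f' v d)"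
        using monotone[OF assms(1) x] \<open>t > 0\<close>
        by (simp add: blinfun.scaleR_right blinfun.diff_left power_mult_distrib power2_eq_square algebra_simps)
      then show ?thesis using \<open>t > 0\<close> by simp
    qed simp
    ultimately show ?thesis by force
  qed
  then have "g 0 \<le> g 1"
    by (intro DERIV_nonneg_imp_nondecreasing[of 0 1 g]) auto
  then show ?thesis by (simp add: g_def d_def)
qed

lemma zero_unique:
  assumes "v \<in> S" "w \<in> S" "f' v = 0" "f' w = 0"
  shows "v = w"
  using monotone[OF assms(1,2)] pos assms(3,4) by (simp add: mult_le_0_iff)

lemma zero_minimizes:
  assumes "z \<in> S" "w \<in> S" "f' z = 0"
  shows "f z \<le> f w"
  using above_tangent[OF assms(1,2)] assms(3) pos
  by (smt (verit) blinfun.zero_left mult_nonneg_nonneg zero_le_power2 half_gt_zero)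

text \<open>By the tangent inequality at \<open>z\<close>, a point \<open>w\<close> with
  \<open>f w <= f z\<close> has distance at most \<open>2 * norm (f' z) / \<alpha> < r\<close> from
  \<open>z\<close>. So the minimum over the closed ball is attained inside, where the gradient must
  vanish.\<close>

lemma zero_exists:
  assumes "cball z r \<subseteq> S" "r > 0" and small: "norm (f' z) < \<alpha> * r / 2"
  obtains w where "w \<in> ball z r" "f' w = 0"
proof -
  have sub: "x \<in> S" if "x \<in> cball z r" for x using that assms(1) by blast
  have z: "z \<in> S" using sub assms(2) by simp
  have tangent: "f z - norm (f' z) * norm (x - z) + \<alpha> / 2 * (norm (x - z))\<^sup>2 \<le> f x" if "x \<in> cball z r" for x
    using above_tangent[OF z sub[OF that]] norm_blinfun[of "f' z" "x - z"] by (simp add: abs_le_iff)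
  \<comment> \<open>The modulus \<open>\<alpha> / 8\<close> comes from the tangent inequalities at
    the midpoint: both endpoints are at distance \<open>norm (x - y) / 2\<close>, and the linear
    terms cancel.\<close>
  obtain w where w: "w \<in> cball z r" "\<And>x. x \<in> cball z r \<Longrightarrow> f w \<le> f x"
  proof (rule strongly_convex_attains_min[of "cball z r" f "f z - norm (f' z) * r" "\<alpha> / 8"])
    show "continuous_on (cball z r) f"
      by (rule has_derivative_continuous_on) (rule has_derivative_at_withinI[OF deriv[OF sub]])
    show "f z - norm (f' z) * r \<le> f x" if "x \<in> cball z r" for x
    proof -
      have "norm (f' z) * norm (x - z) \<le> norm (f' z) * r"
        using that by (intro mult_left_mono) (auto simp: dist_norm norm_minus_commute)
      moreover have "0 \<le> \<alpha> / 2 * (norm (x - z))\<^sup>2" using pos by simp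
      ultimately show ?thesis using tangent[OF that] by linarith
    qed
  next
    fix x y assume xy: "x \<in> cball z r" "y \<in> cball z r"
    let ?m = "midpoint x y"
    show m: "?m \<in> cball z r"
      using xy convex_cball[of z r] midpoint_in_closed_segment[of x y] closed_segment_subset by blast
    have xm: "x - ?m = (1 / 2) *\<^sub>R (x - y)" and ym: "y - ?m = - ((1 / 2) *\<^sub>R (x - y))"
      by (auto simp: midpoint_def algebra_simps simp flip: scaleR_add_left)
    have n: "norm (x - ?m) = norm (x - y) / 2" "norm (y - ?m) = norm (x - y) / 2"
      unfolding xm ym by simp_all
    have "f' ?m (x - ?m) + f' ?m (y - ?m) = 0"
      unfolding xm ym by (simp add: blinfun.minus_right)
    moreover have "a + b = 0 \<Longrightarrow> m + a + q \<le> s \<Longrightarrow> m + b + q \<le> t \<Longrightarrow> m \<le> (s + t) / 2 - q" for a b m q s t :: real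
      by argo
    moreover have "\<alpha> / 2 * (norm (x - y) / 2)\<^sup>2 = \<alpha> / 8 * (norm (x - y))\<^sup>2"
      by (simp add: power_divide)
    ultimately show "f ?m \<le> (f x + f y) / 2 - \<alpha> / 8 * (norm (x - y))\<^sup>2"
      using above_tangent[OF sub[OF m] sub[OF xy(1)]] above_tangent[OF sub[OF m] sub[OF xy(2)]]
      unfolding n by metis
  qed (use assms pos in auto)
  have "norm (w - z) < r"
  proof (rule ccontr)
    assume "\<not> norm (w - z) < r"
    then have w_gt: "norm (w - z) \<ge> r" by simp
    have "f w \<le> f z" using w(2)[of z] assms(2) by simp
    then have "(\<alpha> / 2 * norm (w - z)) * norm (w - z) \<le> norm (f' z) * norm (w - z)"
      using tangent[OF w(1)] by (simp add: power2_eq_square)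
    then have "\<alpha> / 2 * norm (w - z) \<le> norm (f' z)"
      by (rule mult_right_le_imp_le) (use w_gt assms(2) in linarith)
    moreover have "\<alpha> / 2 * r \<le> \<alpha> / 2 * norm (w - z)"
      using w_gt pos by (intro mult_left_mono) auto
    ultimately show False using small by simp
  qed
  then have wb: "w \<in> ball z r" by (simp add: dist_norm norm_minus_commute)
  have "blinfun_apply (f' w) = (\<lambda>v. 0)"
    by (rule differential_zero_maxmin[OF wb open_ball deriv[OF sub[OF w(1)]]])
      (use w(2) in auto)
  then have "f' w = 0" by (intro blinfun_eqI) simp
  with wb show ?thesis by (rule that)
qed

lemma gradient_tilt: "strongly_monotone_gradient (\<lambda>w. f w - l w) (\<lambda>w. f' w - l) S \<alpha>"
  for l :: "'a \<Rightarrow>\<^sub>L real"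
proof
  show "((\<lambda>w. f w - l w) has_derivative blinfun_apply (f' w - l)) (at w)" if "w \<in> S" for w
    by (rule has_derivative_eq_rhs[OF has_derivative_diff[OF deriv[OF that]
            bounded_linear_imp_has_derivative[OF blinfun.bounded_linear_right[of l]]]])
      (simp add: fun_eq_iff blinfun.diff_left)
qed (use monotone convex pos in auto)

text \<open>The zero of the tilted gradient \<open>f' - t l\<close> moves by \<open>t A\<^sup>-\<^sup>1 l + o(t)\<close>, so that \<open>l\<close> lies in
  the closure of the range of \<open>A\<close>. This replaces the Lax-Milgram theorem.\<close>

lemma coercive_derivative_surj:
  fixes A :: "'a \<Rightarrow>\<^sub>L 'a \<Rightarrow>\<^sub>L real"
  assumes "cball z r \<subseteq> S" "r > 0" "f' z = 0" and A: "(f' has_derivative blinfun_apply A) (at z)"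
    and coercive: "\<And>v. \<alpha> * norm v \<le> norm (A v)"
  shows "range A = UNIV"
proof -
  \<comment> \<open>The lower bound on \<open>A\<close> makes its range complete, hence closed, so
    density is all that remains.\<close>
  have "complete (range A)"
    using complete_isometric_image[of \<alpha> UNIV A] coercive pos
    by (auto simp: complete_UNIV blinfun.bounded_linear_right)
  then have "closed (range A)" by (rule complete_imp_closed)
  moreover have "l \<in> closure (range A)" for l
    unfolding closure_approachable
  proof (intro allI impI)
    fix e :: real assume "e > 0"
    \<comment> \<open>A positive strict bound for \<open>norm l\<close>, available also for
      \<open>l = 0\<close>.\<close>
    define L where "L = norm l + 1"
    have L: "L > 0" "norm l < L" by (auto simp: L_def add_nonneg_pos)
    define e' where "e' = e * \<alpha> / L"
    have e': "e' > 0" using \<open>e > 0\<close> L pos by (simp add: e'_def)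
    then obtain d where d: "d > 0" "\<And>w. norm (w - z) < d \<Longrightarrow> norm (f' w - f' z - A (w - z)) \<le> e' * norm (w - z)"
      using A unfolding has_derivative_at_alt by blast
    \<comment> \<open>The first entry makes the tilt small enough for \<open>zero_exists\<close> on
      the ball of radius \<open>r\<close>. The second keeps the zero \<open>w\<close> within
      \<open>d\<close> of \<open>z\<close>, as
      \<open>\<alpha> * norm (w - z) <= t * norm l\<close>.\<close>
    define t where "t = min (\<alpha> * r / 2) (\<alpha> * d) / L"
    have t: "t > 0" "t * norm l < \<alpha> * r / 2" "t * norm l < \<alpha> * d"
    proof -
      show "t > 0" using pos assms(2) d L by (simp add: t_def)
      then have "t * norm l < t * L" using L by simp
      moreover have "t * L = min (\<alpha> * r / 2) (\<alpha> * d)" using L by (simp add: t_def)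
      ultimately show "t * norm l < \<alpha> * r / 2" "t * norm l < \<alpha> * d" by auto
    qed
    interpret tilt: strongly_monotone_gradient "\<lambda>w. f w - (t *\<^sub>R l) w" "\<lambda>w. f' w - t *\<^sub>R l" S \<alpha>
      by (rule gradient_tilt)
    obtain w where w: "w \<in> ball z r" "f' w - t *\<^sub>R l = 0"
      using tilt.zero_exists[OF assms(1,2)] t assms(3) by auto
    then have f'w: "f' w = t *\<^sub>R l" by simp
    let ?n = "norm (w - z)"
    have "z \<in> S" "w \<in> S" using assms(1,2) w(1) by auto
    then have "(\<alpha> * ?n) * ?n \<le> (t *\<^sub>R l) (w - z)"
      using monotone[of z w] f'w assms(3) by (simp add: power2_eq_square)
    also have "\<dots> \<le> (t * norm l) * ?n"
      using norm_blinfun[of "t *\<^sub>R l" "w - z"] t by (simp add: abs_le_iff)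
    finally have n: "\<alpha> * ?n \<le> t * norm l"
      using t(1) by (cases "?n = 0") (auto simp: mult_le_cancel_right)
    then have "?n < d" using t(3) pos by (smt (verit) mult_less_cancel_left_pos)
    then have "norm (t *\<^sub>R l - A (w - z)) \<le> e' * ?n"
      using d(2)[of w] f'w assms(3) by simp
    also have "\<dots> < e * t"
    proof -
      have "e' * ?n = e / L * (\<alpha> * ?n)" by (simp add: e'_def)
      also have "\<dots> \<le> e / L * (t * norm l)" using n \<open>e > 0\<close> L by (intro mult_left_mono) auto
      also have "\<dots> < e / L * (t * L)" using \<open>e > 0\<close> L t by (intro mult_strict_left_mono) auto
      finally show ?thesis using L by simp
    qed
    finally have 1: "norm (t *\<^sub>R l - A (w - z)) < e * t" .
    have "t *\<^sub>R (l - A ((w - z) /\<^sub>R t)) = t *\<^sub>R l - A (w - z)"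
      using t(1) unfolding blinfun.scaleR_right by (simp add: scaleR_diff_right)
    then have "t * norm (l - A ((w - z) /\<^sub>R t)) < e * t"
      using 1 t(1) by (metis abs_of_pos norm_scaleR)
    then have "norm (l - A ((w - z) /\<^sub>R t)) < e"
      using t(1) by (simp add: mult.commute)
    then show "\<exists>y\<in>range A. dist y l < e"
      by (intro bexI[of _ "A ((w - z) /\<^sub>R t)"]) (auto simp: dist_norm norm_minus_commute)
  qed
  ultimately show ?thesis by (auto simp: closure_closed)
qed

end

lemma blinfun_inverse_exists:
  fixes A :: "'a::real_normed_vector \<Rightarrow>\<^sub>L 'b::real_normed_vector"
  assumes "range A = UNIV" "c > 0" and lower: "\<And>v. c * norm v \<le> norm (A v)"
  obtains P where "P o\<^sub>L A = id_blinfun" "A o\<^sub>L P = id_blinfun" "norm P \<le> 1 / c"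
proof -
  have inj: "inj A"
  proof (rule injI)
    fix v w assume "A v = A w"
    then show "v = w" using lower[of "v - w"] assms(2) by (simp add: blinfun.diff_right mult_le_0_iff)
  qed
  have inv: "inv A (A v) = v" "A (inv A y) = y" for v y
    using inj assms(1) by (auto simp: surj_f_inv_f)
  have bound: "norm (inv A y) \<le> norm y * (1 / c)" for y
    using lower[of "inv A y"] assms(2) by (simp add: inv field_simps)
  have "bounded_linear (inv A)"
  proof (rule bounded_linear_intro[OF _ _ bound])
    show "inv A (x + y) = inv A x + inv A y" for x y
      by (rule injD[OF inj]) (simp add: inv blinfun.add_right)
    show "inv A (r *\<^sub>R x) = r *\<^sub>R inv A x" for r x
      by (rule injD[OF inj]) (simp add: inv blinfun.scaleR_right)
  qed
  then have P: "blinfun_apply (Blinfun (inv A)) = inv A" by (rule bounded_linear_Blinfun_apply)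
  show ?thesis
  proof (rule that[of "Blinfun (inv A)"])
    show "norm (Blinfun (inv A)) \<le> 1 / c"
      using bound assms(2) by (intro norm_blinfun_bound) (auto simp: P mult.commute)
  qed (auto intro!: blinfun_eqI simp: P inv)
qed

text \<open>Minimality of \<open>u \<mu>\<close> and \<open>u \<nu>\<close> squeezes the increment of the value function between increments
  of \<open>J\<close> in the second variable only, so no differentiability of \<open>u\<close> is needed.\<close>

lemma envelope_has_derivative:
  fixes J :: "'a::real_normed_vector \<times> 'm::real_normed_vector \<Rightarrow> real"
  assumes J': "\<And>p. p \<in> T \<Longrightarrow> (J has_derivative blinfun_apply (J' p)) (at p)" "continuous_on T J'" "open T"
    and "open S" "convex S" "continuous_on S u" "u ` S \<times> S \<subseteq> T"
    and min: "\<And>\<mu> \<nu>. \<mu> \<in> S \<Longrightarrow> \<nu> \<in> S \<Longrightarrow> J (u \<mu>, \<mu>) \<le> J (u \<nu>, \<mu>)" and \<mu>: "\<mu> \<in> S"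
  shows "((\<lambda>\<mu>. J (u \<mu>, \<mu>)) has_derivative blinfun_apply (J' (u \<mu>, \<mu>) o\<^sub>L blinfun_inr)) (at \<mu>)"
proof -
  let ?p = "(u \<mu>, \<mu>)"
  let ?L = "J' ?p o\<^sub>L blinfun_inr"
  have "\<exists>d>0. \<forall>\<nu>. norm (\<nu> - \<mu>) < d \<longrightarrow> norm (J (u \<nu>, \<nu>) - J ?p - ?L (\<nu> - \<mu>)) \<le> e * norm (\<nu> - \<mu>)"
    if e: "e > 0" for e
  proof -
    have pT: "?p \<in> T" using assms(7) \<mu> by blast
    have "isCont J' ?p" using J'(2,3) pT continuous_on_eq_continuous_at by blast
    then obtain d1 where d1: "d1 > 0" "\<And>q. dist q ?p < d1 \<Longrightarrow> dist (J' q) (J' ?p) < e"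
      using e unfolding continuous_at_eps_delta by blast
    have "isCont u \<mu>" using assms(4,6) \<mu> continuous_on_eq_continuous_at by blast
    then obtain d2 where d2: "d2 > 0" "\<And>\<nu>. dist \<nu> \<mu> < d2 \<Longrightarrow> dist (u \<nu>) (u \<mu>) < d1 / 2"
      using d1(1) unfolding continuous_at_eps_delta by (meson half_gt_zero)
    obtain d3 where d3: "d3 > 0" "\<And>\<nu>. dist \<nu> \<mu> < d3 \<Longrightarrow> \<nu> \<in> S"
      using assms(4) \<mu> unfolding open_dist by blast
    define d where "d = min (d1 / 2) (min d2 d3)"
    have "norm (J (u \<nu>, \<nu>) - J ?p - ?L (\<nu> - \<mu>)) \<le> e * norm (\<nu> - \<mu>)" if \<nu>: "norm (\<nu> - \<mu>) < d" for \<nu>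
    proof -
      have \<nu>S: "\<nu> \<in> S" using \<nu> d3(2) by (simp add: d_def dist_norm)
      \<comment> \<open>The mean value theorem in the parameter alone, with \<open>w\<close> frozen.
        It serves \<open>w = u \<mu>\<close> and \<open>w = u \<nu>\<close>; in both cases the
        segment stays within \<open>d1\<close> of \<open>?p\<close>.\<close>
      have incr: "\<bar>J (w, \<nu>) - J (w, \<mu>) - ?L (\<nu> - \<mu>)\<bar> \<le> e * norm (\<nu> - \<mu>)"
        if w: "w \<in> u ` S" "dist w (u \<mu>) < d1 / 2" for w
      proof -
        let ?q = "\<lambda>t. (w, \<mu>) + t *\<^sub>R (0, \<nu> - \<mu>)"
        have qT: "?q t \<in> T" if "0 \<le> t" "t \<le> 1" for t
          using convex_segment_point[OF assms(5) \<mu> \<nu>S that] w(1) assms(7) by auto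
        have "\<exists>t>0. t < 1 \<and> J (?q 1) - J (?q 0) = (1 - 0) * J' (?q t) (0, \<nu> - \<mu>)"
          using has_derivative_along_line[OF J'(1)[OF qT]]
          by (intro MVT2) (auto simp: has_real_derivative_iff_has_vector_derivative)
        then obtain t where t: "0 < t" "t < 1" "J (w, \<nu>) - J (w, \<mu>) = J' (?q t) (0, \<nu> - \<mu>)"
          by auto
        have "dist (?q t) ?p \<le> dist w (u \<mu>) + norm (t *\<^sub>R (\<nu> - \<mu>))"
          using norm_Pair_le[of "w - u \<mu>" "t *\<^sub>R (\<nu> - \<mu>)"] by (simp add: dist_norm)
        also have "\<dots> < d1 / 2 + d1 / 2"
          using w(2) \<nu> t mult_left_le_one_le[of "norm (\<nu> - \<mu>)" t]
          by (intro add_strict_mono) (auto simp: d_def)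
        finally have "norm (J' (?q t) - J' ?p) \<le> e"
          using d1(2)[of "?q t"] by (simp add: dist_norm)
        then have "norm ((J' (?q t) - J' ?p) (0, \<nu> - \<mu>)) \<le> e * norm (0 :: 'a, \<nu> - \<mu>)"
          by (rule order_trans[OF norm_blinfun mult_right_mono]) simp
        then show ?thesis using t(3) by (simp add: blinfun.diff_left norm_Pair)
      qed
      \<comment> \<open>The increment of the value function is at most that of \<open>J\<close> with
        first argument frozen at \<open>u \<mu>\<close>, and at least that with
        \<open>u \<nu>\<close>.\<close>
      have "J (u \<nu>, \<nu>) \<le> J (u \<mu>, \<nu>)" "J (u \<mu>, \<mu>) \<le> J (u \<nu>, \<mu>)"
        using min \<mu> \<nu>S by auto
      moreover have "dist (u \<nu>) (u \<mu>) < d1 / 2" using d2(2) \<nu> by (simp add: d_def dist_norm)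
      ultimately show ?thesis
        using incr[of "u \<mu>"] incr[of "u \<nu>"] \<mu> \<nu>S d1(1) by auto
    qed
    then show ?thesis using d1 d2 d3 by (intro exI[of _ d]) (auto simp: d_def)
  qed
  then show ?thesis
    unfolding has_derivative_at_alt by (auto simp: blinfun.bounded_linear_right)
qed

section \<open>Minimizers depending on a parameter\<close>

lemma fderiv_eq: "(f has_derivative blinfun_apply D) (at x) \<Longrightarrow> fderiv f x = D"
  unfolding fderiv_def by (simp add: frechet_derivative_at[symmetric] blinfun_apply_inverse)

text \<open>On an open set derivatives are unique, which identifies the unnamed derivative of
  \<open>Ck_on_Suc\<close> with \<open>fderiv\<close>.\<close>

lemma Ck_on_Suc_fderiv:
  assumes "open S" "Ck_on (Suc k) f S"
  shows "x \<in> S \<Longrightarrow> (f has_derivative blinfun_apply (fderiv f x)) (at x)"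
    and "Ck_on k (fderiv f) S"
proof -
  from iffD1[OF Ck_on_Suc assms(2)]
  obtain f' where f': "\<forall>x\<in>S. (f has_derivative blinfun_apply (f' x)) (at x within S)" "Ck_on k f' S"
    by blast
  have at: "(f has_derivative blinfun_apply (f' x)) (at x)" if "x \<in> S" for x
    using bspec[OF f'(1) that] by (simp only: at_within_open[OF that assms(1)])
  have eq: "fderiv f x = f' x" if "x \<in> S" for x
    using fderiv_eq[OF at[OF that]] .
  show "x \<in> S \<Longrightarrow> (f has_derivative blinfun_apply (fderiv f x)) (at x)"
    using at eq by simp
  show "Ck_on k (fderiv f) S"
    by (rule iffD2[OF Ck_on_cong[OF eq] f'(2)])
qed

lemma has_derivative_blinfun_unique:
  "(f has_derivative blinfun_apply D) (at x) \<Longrightarrow> (f has_derivative blinfun_apply D') (at x) \<Longrightarrow> D = D'"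
  using fderiv_eq by metis

lemma has_derivative_fst_slice:
  assumes "(f has_derivative blinfun_apply D) (at (w, \<mu>))"
  shows "((\<lambda>w. f (w, \<mu>)) has_derivative blinfun_apply (D o\<^sub>L blinfun_inl)) (at w)"
proof -
  have "((\<lambda>w. (w, \<mu>)) has_derivative (\<lambda>h. (h, 0))) (at w)"
    by (auto intro!: derivative_eq_intros)
  from has_derivative_compose[OF this assms] show ?thesis
    by (rule has_derivative_eq_rhs) (simp add: fun_eq_iff)
qed

lemma has_derivative_snd_slice:
  assumes "(f has_derivative blinfun_apply D) (at (w, \<mu>))"
  shows "((\<lambda>\<mu>. f (w, \<mu>)) has_derivative blinfun_apply (D o\<^sub>L blinfun_inr)) (at \<mu>)"
proof -
  have "((\<lambda>\<mu>. (w, \<mu>)) has_derivative (\<lambda>h. (0, h))) (at \<mu>)"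
    by (auto intro!: derivative_eq_intros)
  from has_derivative_compose[OF this assms] show ?thesis
    by (rule has_derivative_eq_rhs) (simp add: fun_eq_iff)
qed

lemma partial_X_eq:
  "(J has_derivative blinfun_apply D) (at (w, \<mu>)) \<Longrightarrow> partial_X J (w, \<mu>) = D o\<^sub>L blinfun_inl"
  unfolding partial_X_def by (simp add: fderiv_eq[OF has_derivative_fst_slice])

lemma partial_M_eq:
  "(J has_derivative blinfun_apply D) (at (w, \<mu>)) \<Longrightarrow> partial_M J (w, \<mu>) = D o\<^sub>L blinfun_inr"
  unfolding partial_M_def by (simp add: fderiv_eq[OF has_derivative_snd_slice])

lemma C2_partial_derivatives:
  assumes "open U" "Ck_on 2 (\<lambda>w. J (w, \<mu>)) U" "w \<in> U"
  shows "((\<lambda>w. J (w, \<mu>)) has_derivative blinfun_apply (partial_X J (w, \<mu>))) (at w)"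
    and "((\<lambda>w. partial_X J (w, \<mu>)) has_derivative blinfun_apply (partial_XX J (w, \<mu>))) (at w)"
proof -
  have C2: "Ck_on (Suc (Suc 0)) (\<lambda>w. J (w, \<mu>)) U"
    using assms(2) by (simp only: numeral_2_eq_2)
  have X: "fderiv (\<lambda>w. J (w, \<mu>)) = (\<lambda>w. partial_X J (w, \<mu>))"
    by (simp add: partial_X_def)
  have XX: "fderiv (\<lambda>w. partial_X J (w, \<mu>)) = (\<lambda>w. partial_XX J (w, \<mu>))"
    by (simp add: partial_XX_def)
  note C1 = Ck_on_Suc_fderiv[OF assms(1) C2, unfolded X]
  show "((\<lambda>w. J (w, \<mu>)) has_derivative blinfun_apply (partial_X J (w, \<mu>))) (at w)"
    by (rule C1(1)[OF assms(3)])
  show "((\<lambda>w. partial_X J (w, \<mu>)) has_derivative blinfun_apply (partial_XX J (w, \<mu>))) (at w)"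
    by (rule Ck_on_Suc_fderiv(1)[OF assms(1) C1(2) assms(3), unfolded XX])
qed

lemma local_minimizer_imp_critical:
  assumes "open U" "local_minimizer f U w" "(f has_derivative blinfun_apply D) (at w)"
  shows "D = 0"
proof -
  obtain G where G: "openin (top_of_set U) G" "w \<in> G" "\<And>v. v \<in> G \<Longrightarrow> f w \<le> f v"
    using assms(2) unfolding local_minimizer_def global_minimizer_def by blast
  have "open G" using G(1) assms(1) by (meson openin_open_eq)
  then have "blinfun_apply D = (\<lambda>v. 0)"
    using G(2,3) by (intro differential_zero_maxmin[OF _ _ assms(3)]) auto
  then show ?thesis by (intro blinfun_eqI) simp
qed

lemma coercive_nearby:
  fixes A B :: "'a::real_normed_vector \<Rightarrow>\<^sub>L 'a \<Rightarrow>\<^sub>L real"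
  assumes "\<And>h. \<alpha> * (norm h)\<^sup>2 \<le> A h h" "norm (B - A) \<le> \<alpha> / 2"
  shows "\<alpha> / 2 * (norm h)\<^sup>2 \<le> B h h"
proof -
  have "norm ((B - A) h h) \<le> norm (B - A) * norm h * norm h"
    by (rule order_trans[OF norm_blinfun mult_right_mono[OF norm_blinfun]]) simp
  also have "\<dots> \<le> \<alpha> / 2 * norm h * norm h"
    by (intro mult_right_mono assms(2)) auto
  finally have "\<bar>B h h - A h h\<bar> \<le> \<alpha> / 2 * (norm h)\<^sup>2"
    by (simp add: blinfun.diff_left power2_eq_square mult.assoc)
  then show ?thesis
    using assms(1)[of h] unfolding abs_le_iff by argo
qed

lemma coercive_imp_bounded_below:
  fixes A :: "'a::real_normed_vector \<Rightarrow>\<^sub>L 'a \<Rightarrow>\<^sub>L real"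
  assumes "\<alpha> * (norm h)\<^sup>2 \<le> A h h"
  shows "\<alpha> * norm h \<le> norm (A h)"
proof (cases "h = 0")
  case False
  have "\<alpha> * norm h * norm h \<le> norm (A h) * norm h"
    using assms norm_blinfun[of "A h" h] by (simp add: power2_eq_square mult.assoc abs_le_iff)
  then show ?thesis using False by simp
qed simp

text \<open>Monotonicity at the parameter \<open>\<nu>\<close>, where \<open>u \<nu>\<close> is a
  zero, bounds the distance from \<open>u \<mu>\<close> to \<open>u \<nu>\<close> by
  \<open>norm (F (u \<mu>, \<nu>)) / \<alpha>\<close>. Only the parameter moves in this bound, and
  its limit is 0.\<close>

lemma strongly_monotone_zeros_continuous:
  fixes F :: "'x::real_normed_vector \<times> 'm::metric_space \<Rightarrow> 'x \<Rightarrow>\<^sub>L real"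
  assumes cont: "continuous_on (V \<times> S) F" and "\<alpha> > 0"
    and mono: "\<And>v w \<mu>. v \<in> V \<Longrightarrow> w \<in> V \<Longrightarrow> \<mu> \<in> S \<Longrightarrow>
      \<alpha> * (norm (w - v))\<^sup>2 \<le> (F (w, \<mu>) - F (v, \<mu>)) (w - v)"
    and u: "\<And>\<mu>. \<mu> \<in> S \<Longrightarrow> u \<mu> \<in> V" "\<And>\<mu>. \<mu> \<in> S \<Longrightarrow> F (u \<mu>, \<mu>) = 0"
  shows "continuous_on S u"
  unfolding continuous_on_def
proof
  fix \<mu> assume \<mu>: "\<mu> \<in> S"
  have "continuous_on S (\<lambda>\<nu>. F (u \<mu>, \<nu>))"
    by (rule continuous_on_compose2[OF cont]) (auto intro!: continuous_intros u \<mu>)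
  then have "((\<lambda>\<nu>. norm (F (u \<mu>, \<nu>)) / \<alpha>) \<longlongrightarrow> norm (F (u \<mu>, \<mu>)) / \<alpha>) (at \<mu> within S)"
    using \<mu> \<open>\<alpha> > 0\<close> by (intro tendsto_intros) (auto simp: continuous_on_def)
  then have lim: "((\<lambda>\<nu>. norm (F (u \<mu>, \<nu>)) / \<alpha>) \<longlongrightarrow> 0) (at \<mu> within S)"
    by (simp add: u(2)[OF \<mu>])
  have "norm (u \<nu> - u \<mu>) \<le> norm (F (u \<mu>, \<nu>)) / \<alpha>" if \<nu>: "\<nu> \<in> S" for \<nu>
  proof -
    let ?d = "u \<nu> - u \<mu>"
    have "\<alpha> * norm ?d * norm ?d \<le> - F (u \<mu>, \<nu>) ?d"
      using mono[OF u(1)[OF \<mu>] u(1)[OF \<nu>] \<nu>] u(2)[OF \<nu>]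
      by (simp add: power2_eq_square blinfun.minus_left mult.assoc)
    also have "\<dots> \<le> norm (F (u \<mu>, \<nu>)) * norm ?d"
      using norm_blinfun[of "F (u \<mu>, \<nu>)" ?d] by (simp add: abs_le_iff)
    finally have "\<alpha> * norm ?d \<le> norm (F (u \<mu>, \<nu>))"
      by (cases "?d = 0") (auto simp: mult_le_cancel_right)
    then show ?thesis using \<open>\<alpha> > 0\<close> by (simp add: field_simps)
  qed
  then have "((\<lambda>\<nu>. u \<nu> - u \<mu>) \<longlongrightarrow> 0) (at \<mu> within S)"
    by (rule null_comparison_within[OF lim])
  then show "(u \<longlongrightarrow> u \<mu>) (at \<mu> within S)" by (simp add: LIM_zero_iff)
qed

theorem theorem0p2p6:
  fixes U :: "'x::banach set"
    and Om :: "'m::banach set"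
    and J :: "'x \<times> 'm \<Rightarrow> real"
    and u0 :: 'x
    and mu0 :: 'm
    and k :: nat
  assumes "open U" and "open Om" and "mu0 \<in> Om"
    and "\<And>\<mu>. \<mu> \<in> Om \<Longrightarrow> Ck_on 2 (\<lambda>w. J (w, \<mu>)) U"
    and "continuous_on (U \<times> Om) (partial_X J)"
    and "u0 \<in> U" and "partial_X J (u0, mu0) = 0"
    and "continuous (at (u0, mu0) within U \<times> Om) (partial_XX J)"
    and "\<exists>\<alpha>>0. \<forall>w. partial_XX J (u0, mu0) w w \<ge> \<alpha> * (norm w)\<^sup>2"
    and "k \<ge> 1" and "Ck_on k J (U \<times> Om)"
  shows "\<exists>U0 Om0 (u :: 'm \<Rightarrow> 'x).
      open (U0 \<times> Om0) \<and> convex (U0 \<times> Om0) \<and> (u0, mu0) \<in> U0 \<times> Om0 \<and> U0 \<times> Om0 \<subseteq> U \<times> Om \<and>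
      continuous_on Om0 u \<and> u ` Om0 \<subseteq> U0 \<and>
      (\<forall>\<mu>\<in>Om0.
        (\<forall>w\<in>U0. (local_minimizer (\<lambda>w. J (w, \<mu>)) U w \<longleftrightarrow> partial_X J (w, \<mu>) = 0) \<and>
                 (partial_X J (w, \<mu>) = 0 \<longleftrightarrow> w = u \<mu>)) \<and>
        global_minimizer (\<lambda>w. J (w, \<mu>)) U0 (u \<mu>)) \<and>
      Ck_on k (\<lambda>\<mu>. J (u \<mu>, \<mu>)) Om0 \<and>
      (\<forall>\<mu>\<in>Om0. ((\<lambda>\<mu>. J (u \<mu>, \<mu>)) has_derivative blinfun_apply (partial_M J (u \<mu>, \<mu>))) (at \<mu>))"
proof -
  let ?F = "partial_X J" and ?A = "partial_XX J"
  have J_X: "((\<lambda>w. J (w, \<mu>)) has_derivative blinfun_apply (?F (w, \<mu>))) (at w)"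
    and F_X: "((\<lambda>w. ?F (w, \<mu>)) has_derivative blinfun_apply (?A (w, \<mu>))) (at w)"
    if "w \<in> U" "\<mu> \<in> Om" for w \<mu>
    using C2_partial_derivatives[OF assms(1,4)] that by auto

  obtain \<alpha> where "\<alpha> > 0" and \<alpha>: "\<And>w. \<alpha> * (norm w)\<^sup>2 \<le> ?A (u0, mu0) w w"
    using assms(9) by blast
  \<comment> \<open>Half of the coercivity at \<open>(u0, mu0)\<close> is given up to retain
    coercivity on a neighborhood.\<close>
  define \<beta> where "\<beta> = \<alpha> / 2"
  have \<beta>: "\<beta> > 0" using \<open>\<alpha> > 0\<close> by (simp add: \<beta>_def)
  obtain \<delta> where \<delta>: "\<delta> > 0"
    "\<And>p. p \<in> U \<times> Om \<Longrightarrow> dist p (u0, mu0) < \<delta> \<Longrightarrow> dist (?A p) (?A (u0, mu0)) < \<beta>"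
    using assms(8) \<beta> unfolding continuous_within_eps_delta by blast
  obtain r1 where r1: "r1 > 0" "cball u0 r1 \<subseteq> U"
    using assms(1,6) open_contains_cball by blast
  \<comment> \<open>The factor \<open>1 / 3\<close> leaves \<open>r\<close> strictly below
    \<open>\<delta> / 2\<close>, so even the closed ball in \<open>w\<close>, paired with parameters
    closer than \<open>\<delta> / 2\<close>, stays within \<open>\<delta>\<close>.\<close>
  define r where "r = min r1 (\<delta> / 3)"
  have r: "r > 0" "cball u0 r \<subseteq> U" "r < \<delta> / 2"
    using r1 \<delta>(1) by (auto simp: r_def)
  obtain \<rho>1 where \<rho>1: "\<rho>1 > 0" "ball mu0 \<rho>1 \<subseteq> Om"
    using assms(2,3) open_contains_ball by blast
  have "continuous_on Om (\<lambda>\<mu>. ?F (u0, \<mu>))"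
    by (rule continuous_on_compose2[OF assms(5)]) (auto intro!: continuous_intros assms(6))
  then have "isCont (\<lambda>\<mu>. ?F (u0, \<mu>)) mu0"
    using assms(3) by (simp add: continuous_on_eq_continuous_at assms(2))
  \<comment> \<open>The threshold \<open>\<beta> * r / 2\<close> is the one in
    \<open>zero_exists\<close> for radius \<open>r\<close> and modulus
    \<open>\<beta>\<close>.\<close>
  then obtain \<rho>2 where \<rho>2: "\<rho>2 > 0" "\<And>\<mu>. dist \<mu> mu0 < \<rho>2 \<Longrightarrow> norm (?F (u0, \<mu>)) < \<beta> * r / 2"
    using \<beta> r(1) assms(7) unfolding continuous_at_eps_delta dist_norm
    by (metis diff_zero half_gt_zero mult_pos_pos)
  \<comment> \<open>Minimization takes place on the closed ball; the critical points found there lie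
    in this open one.\<close>
  define U0 where "U0 = ball u0 r"
  define Om0 where "Om0 = ball mu0 (min (\<delta> / 2) (min \<rho>1 \<rho>2))"
  have U0: "open U0" "U0 \<subseteq> cball u0 r" "U0 \<subseteq> U" "u0 \<in> U0" "convex U0"
    using r by (auto simp: U0_def)
  have Om0: "open Om0" "convex Om0" "mu0 \<in> Om0" "Om0 \<subseteq> Om"
    and F_small: "\<And>\<mu>. \<mu> \<in> Om0 \<Longrightarrow> norm (?F (u0, \<mu>)) < \<beta> * r / 2"
    using \<delta>(1) \<rho>1 \<rho>2 by (auto simp: Om0_def dist_commute)
  have coercive: "\<beta> * (norm h)\<^sup>2 \<le> ?A (w, \<mu>) h h" if "w \<in> cball u0 r" "\<mu> \<in> Om0" for w \<mu> h
  proof -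
    have "dist (w, \<mu>) (u0, mu0) \<le> dist w u0 + dist \<mu> mu0"
      using norm_Pair_le[of "w - u0" "\<mu> - mu0"] by (simp add: dist_norm)
    also have "\<dots> < \<delta> / 2 + \<delta> / 2"
      using that r(3) by (intro add_strict_mono) (auto simp: Om0_def dist_commute)
    finally have "dist (w, \<mu>) (u0, mu0) < \<delta>" by simp
    moreover have "(w, \<mu>) \<in> U \<times> Om"
      using that r(2) Om0(4) by blast
    ultimately have "norm (?A (w, \<mu>) - ?A (u0, mu0)) \<le> \<alpha> / 2"
      using \<delta>(2)[of "(w, \<mu>)"] by (simp add: dist_norm \<beta>_def)
    from coercive_nearby[OF \<alpha> this] show ?thesis by (simp add: \<beta>_def)
  qed
  have gradient: "strongly_monotone_gradient (\<lambda>w. J (w, \<mu>)) (\<lambda>w. ?F (w, \<mu>)) (cball u0 r) \<beta>"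
    if \<mu>: "\<mu> \<in> Om0" for \<mu>
  proof
    show "((\<lambda>w. J (w, \<mu>)) has_derivative blinfun_apply (?F (w, \<mu>))) (at w)" if "w \<in> cball u0 r" for w
      using J_X that \<mu> r(2) Om0(4) by blast
    show "\<beta> * (norm (w - v))\<^sup>2 \<le> (?F (w, \<mu>) - ?F (v, \<mu>)) (w - v)"
      if "v \<in> cball u0 r" "w \<in> cball u0 r" for v w
      by (rule coercive_imp_strongly_monotone[OF convex_cball that F_X coercive])
        (use \<mu> r(2) Om0(4) in auto)
  qed (use \<beta> in auto)

  have "\<exists>w\<in>U0. ?F (w, \<mu>) = 0" if "\<mu> \<in> Om0" for \<mu>
    using strongly_monotone_gradient.zero_exists[OF gradient[OF that] order_refl r(1) F_small[OF that]]
    unfolding U0_def by blast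
  then obtain u where u: "\<And>\<mu>. \<mu> \<in> Om0 \<Longrightarrow> u \<mu> \<in> U0" "\<And>\<mu>. \<mu> \<in> Om0 \<Longrightarrow> ?F (u \<mu>, \<mu>) = 0"
    by metis
  have zero_iff: "?F (w, \<mu>) = 0 \<longleftrightarrow> w = u \<mu>" if "w \<in> U0" "\<mu> \<in> Om0" for w \<mu>
    using strongly_monotone_gradient.zero_unique[OF gradient[OF that(2)]] that u U0(2) by blast
  have min: "J (u \<mu>, \<mu>) \<le> J (w, \<mu>)" if "w \<in> U0" "\<mu> \<in> Om0" for w \<mu>
    using strongly_monotone_gradient.zero_minimizes[OF gradient[OF that(2)]] that u U0(2) by blast
  have global: "global_minimizer (\<lambda>w. J (w, \<mu>)) U0 (u \<mu>)" if "\<mu> \<in> Om0" for \<mu>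
    using min u(1) that by (simp add: global_minimizer_def)
  have local_iff: "local_minimizer (\<lambda>w. J (w, \<mu>)) U w \<longleftrightarrow> ?F (w, \<mu>) = 0" if "w \<in> U0" "\<mu> \<in> Om0" for w \<mu>
  proof
    show "?F (w, \<mu>) = 0" if "local_minimizer (\<lambda>w. J (w, \<mu>)) U w"
      using local_minimizer_imp_critical[OF assms(1) that J_X] \<open>w \<in> U0\<close> \<open>\<mu> \<in> Om0\<close> U0(3) Om0(4) by blast
    show "local_minimizer (\<lambda>w. J (w, \<mu>)) U w" if "?F (w, \<mu>) = 0"
      unfolding local_minimizer_def using global[OF \<open>\<mu> \<in> Om0\<close>] zero_iff[OF \<open>w \<in> U0\<close> \<open>\<mu> \<in> Om0\<close>] that U0 \<open>w \<in> U0\<close>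
      by (intro exI[of _ U0]) (simp add: openin_open_eq assms(1))
  qed
  have F_mono: "\<beta> * (norm (w - v))\<^sup>2 \<le> (?F (w, \<mu>) - ?F (v, \<mu>)) (w - v)"
    if "v \<in> U0" "w \<in> U0" "\<mu> \<in> Om0" for v w \<mu>
    using strongly_monotone_gradient.monotone[OF gradient[OF that(3)]] that U0(2) by blast
  have u_cont: "continuous_on Om0 u"
    by (rule strongly_monotone_zeros_continuous[OF _ \<beta> F_mono u])
      (use U0(3) Om0(4) in \<open>auto intro: continuous_on_subset[OF assms(5)]\<close>)

  obtain j where k: "k = Suc j" using assms(10) by (cases k) auto
  let ?T = "U \<times> Om"
  have T: "open ?T" by (intro open_Times assms)
  define J' where "J' = fderiv J"
  note J' = Ck_on_Suc_fderiv[OF T assms(11)[unfolded k], folded J'_def]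
  have uT: "(u \<mu>, \<mu>) \<in> ?T" if "\<mu> \<in> Om0" for \<mu>
    using u(1) U0(3) Om0(4) that by blast
  have F_eq: "?F p = J' p o\<^sub>L blinfun_inl" if "p \<in> ?T" for p
    using partial_X_eq[of J "J' p" "fst p" "snd p"] J'(1)[OF that] by simp
  note comp = bounded_bilinear.bounded_linear_left[OF bounded_bilinear_blinfun_compose]
  have u_Ck: "Ck_on j u Om0"
  proof (cases j)
    case 0
    then show ?thesis using u_cont by (simp add: Ck_on_0)
  next
    case (Suc i)
    \<comment> \<open>Here \<open>J\<close> is of class \<open>C^(i+2)\<close>, so \<open>?F\<close>
      is \<open>C^(i+1)\<close> and \<open>F'\<close> is \<open>C^i\<close>; implicit
      differentiation returns \<open>i + 1 = j\<close> as the class of \<open>u\<close>.\<close>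
    define F' where "F' = fderiv ?F"
    have "Ck_on (Suc i) ?F ?T"
      by (rule iffD2[OF Ck_on_cong[OF F_eq] Ck_on_bounded_linear[OF comp T J'(2)[unfolded Suc]]])
    note F' = Ck_on_Suc_fderiv[OF T this, folded F'_def]
    have "\<exists>P. P o\<^sub>L (F' (u \<mu>, \<mu>) o\<^sub>L blinfun_inl) = id_blinfun
        \<and> (F' (u \<mu>, \<mu>) o\<^sub>L blinfun_inl) o\<^sub>L P = id_blinfun \<and> norm P \<le> 1 / \<beta>" if \<mu>: "\<mu> \<in> Om0" for \<mu>
    proof -
      \<comment> \<open>The \<open>X\<close>-part of the joint derivative is the second partial
        derivative, whose coercivity is known on the closed ball.\<close>
      have F'_inl: "F' (u \<mu>, \<mu>) o\<^sub>L blinfun_inl = ?A (u \<mu>, \<mu>)"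
        using has_derivative_blinfun_unique[OF has_derivative_fst_slice[OF F'(1)[OF uT[OF \<mu>]]] F_X]
          u(1)[OF \<mu>] U0(3) Om0(4) \<mu> by blast
      have lower: "\<beta> * norm v \<le> norm (?A (u \<mu>, \<mu>) v)" for v
        using coercive_imp_bounded_below[OF coercive] u(1)[OF \<mu>] U0(2) \<mu> by blast
      \<comment> \<open>Room around \<open>u \<mu>\<close> for the zeros of the tilted
        gradients.\<close>
      obtain s where s: "s > 0" "cball (u \<mu>) s \<subseteq> cball u0 r"
        using u(1)[OF \<mu>] U0(1,2) open_contains_cball by (metis order_trans)
      have "range (?A (u \<mu>, \<mu>)) = UNIV"
        by (rule strongly_monotone_gradient.coercive_derivative_surj[OF gradient[OF \<mu>] s(2,1) u(2)[OF \<mu>] F_X lower])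
          (use u(1)[OF \<mu>] U0(3) Om0(4) \<mu> in auto)
      from blinfun_inverse_exists[OF this \<beta> lower] show ?thesis
        unfolding F'_inl by blast
    qed
    then obtain P where "\<And>\<mu>. \<mu> \<in> Om0 \<Longrightarrow> P \<mu> o\<^sub>L (F' (u \<mu>, \<mu>) o\<^sub>L blinfun_inl) = id_blinfun"
      "\<And>\<mu>. \<mu> \<in> Om0 \<Longrightarrow> (F' (u \<mu>, \<mu>) o\<^sub>L blinfun_inl) o\<^sub>L P \<mu> = id_blinfun"
      "\<And>\<mu>. \<mu> \<in> Om0 \<Longrightarrow> norm (P \<mu>) \<le> 1 / \<beta>"
      by metis
    from Ck_on_implicit[OF Om0(1) T u_cont uT u(2) F' this] show ?thesis
      unfolding Suc .
  qed

  let ?D = "\<lambda>\<mu>. J' (u \<mu>, \<mu>) o\<^sub>L blinfun_inr"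
  have "Ck_on j (\<lambda>\<mu>. J' (u \<mu>, \<mu>)) Om0"
    by (rule Ck_on_compose[OF Om0(1) T _ J'(2) Ck_on_Pair[OF u_Ck Ck_on_id Om0(1)]])
      (use uT in blast)
  from Ck_on_bounded_linear[OF comp Om0(1) this] have D_Ck: "Ck_on j ?D Om0" .
  have J'_cont: "continuous_on ?T J'"
    using Ck_on_mono[OF J'(2), of 0] by (simp add: Ck_on_0)
  have u_sub: "u ` Om0 \<times> Om0 \<subseteq> ?T" using u(1) U0(3) Om0(4) by blast
  \<comment> \<open>The minimality that enters compares only values of \<open>u\<close>, and these
    all lie in \<open>U0\<close>.\<close>
  have deriv: "((\<lambda>\<mu>. J (u \<mu>, \<mu>)) has_derivative blinfun_apply (?D \<mu>)) (at \<mu>)" if "\<mu> \<in> Om0" for \<mu>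
    by (rule envelope_has_derivative[OF J'(1) J'_cont T Om0(1,2) u_cont u_sub min[OF u(1)] that])
  have "Ck_on k (\<lambda>\<mu>. J (u \<mu>, \<mu>)) Om0"
    unfolding k by (rule Ck_on_SucI[OF has_derivative_at_withinI[OF deriv] D_Ck])
  moreover have "((\<lambda>\<mu>. J (u \<mu>, \<mu>)) has_derivative blinfun_apply (partial_M J (u \<mu>, \<mu>))) (at \<mu>)"
    if "\<mu> \<in> Om0" for \<mu>
    using deriv[OF that] by (simp only: partial_M_eq[OF J'(1)[OF uT[OF that]]])
  moreover have "open (U0 \<times> Om0)" "convex (U0 \<times> Om0)"
    using U0 Om0 by (auto intro: open_Times convex_Times)
  ultimately show ?thesis
    using U0 Om0 u_cont u(1) local_iff zero_iff global
    by (intro exI[of _ U0] exI[of _ Om0] exI[of _ u] conjI ballI) auto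
qed

end
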